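(* Let $M$ and $N$ be von Neumann algebras with separable predual, equipped with faithful normal states $\varphi$ and $\psi$ respectively. Then the space of all state-preserving ucp maps $\Phi:(M,\varphi)\to(N,\psi)$ is a Polish space for the topology of pointwise strong convergence (i.e. the coarsest topology making $\Phi\mapsto\Phi(x)$ continuous into $N$ with the strong operator topology, for every $x\in M$).
   Context: A ucp map is a unital completely positive linear map. A ucp map $\Phi:M\to N$ is state-preserving if $\psi\circ\Phi=\varphi$ (no normality is assumed). The strong operator topology on $N$ is taken in the GNS representation on $\mathrm{L}^2(N,\psi)$. A topological space is Polish if it is separable and admits a compatible complete metric. *)

theory Defs
  imports "HOL-Analysis.Analysis"
begin

section \<open>Complex Hilbert spaces and their bounded operators\<close>

text \<open>The inner product is linear in the second argument. Positivity and definiteness of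
  \<open>cinner\<close> are contained in the last axiom, since \<open>norm\<close> is a norm.\<close>

class chilbert_space = banach +
  fixes scaleC :: "complex \<Rightarrow> 'a \<Rightarrow> 'a"
    and cinner :: "'a \<Rightarrow> 'a \<Rightarrow> complex"
  assumes scaleC_add_right: "scaleC a (x + y) = scaleC a x + scaleC a y"
    and scaleC_add_left: "scaleC (a + b) x = scaleC a x + scaleC b x"
    and scaleC_scaleC: "scaleC a (scaleC b x) = scaleC (a * b) x"
    and scaleR_eq_scaleC: "scaleR r x = scaleC (complex_of_real r) x"
    and cinner_commute: "cinner x y = cnj (cinner y x)"
    and cinner_add_right: "cinner x (y + z) = cinner x y + cinner x z"
    and cinner_scaleC_right: "cinner x (scaleC a y) = a * cinner x y"
    and norm_eq_sqrt_cinner: "norm x = sqrt (Re (cinner x x))"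

text \<open>\<open>'h \<Rightarrow>\<^sub>L 'h\<close> consists of the bounded real-linear operators, with the operator norm;
  \<open>bounded_ops\<close> is the algebra B(H) of the complex-linear ones.\<close>

definition bounded_ops :: "('h::chilbert_space \<Rightarrow>\<^sub>L 'h) set" where
  "bounded_ops = {T :: 'h \<Rightarrow>\<^sub>L 'h. \<forall>c \<xi>. T (scaleC c \<xi>) = scaleC c (T \<xi>)}"

definition op_scale :: "complex \<Rightarrow> ('h::chilbert_space \<Rightarrow>\<^sub>L 'h) \<Rightarrow> ('h \<Rightarrow>\<^sub>L 'h)" where
  "op_scale c T = Blinfun (\<lambda>\<xi>. scaleC c (T \<xi>))"

definition op_adjoint :: "('h::chilbert_space \<Rightarrow>\<^sub>L 'h) \<Rightarrow> ('h \<Rightarrow>\<^sub>L 'h)" where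
  "op_adjoint T = (THE S :: 'h \<Rightarrow>\<^sub>L 'h. \<forall>\<xi> \<eta>. cinner (S \<xi>) \<eta> = cinner \<xi> (T \<eta>))"

definition positive_op :: "('h::chilbert_space \<Rightarrow>\<^sub>L 'h) \<Rightarrow> bool" where
  "positive_op T \<longleftrightarrow> (\<forall>\<xi>. cinner \<xi> (T \<xi>) \<in> \<real>\<^sub>\<ge>\<^sub>0)"

text \<open>Positivity of the operator matrix \<open>(x i j)\<close>, \<open>i, j < n\<close>, acting on the n-fold direct sum
  of the Hilbert space.\<close>

definition positive_matrix :: "nat \<Rightarrow> (nat \<Rightarrow> nat \<Rightarrow> ('h::chilbert_space \<Rightarrow>\<^sub>L 'h)) \<Rightarrow> bool" where
  "positive_matrix n x \<longleftrightarrow>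
     (\<forall>\<xi>. (\<Sum>i<n. cinner (\<xi> i) (\<Sum>j<n. x i j (\<xi> j))) \<in> \<real>\<^sub>\<ge>\<^sub>0)"

section \<open>Von Neumann algebras, preduals, states\<close>

definition commutant :: "('h::chilbert_space \<Rightarrow>\<^sub>L 'h) set \<Rightarrow> ('h \<Rightarrow>\<^sub>L 'h) set" where
  "commutant S = {T \<in> bounded_ops. \<forall>A\<in>S. T o\<^sub>L A = A o\<^sub>L T}"

definition von_neumann_algebra :: "('h::chilbert_space \<Rightarrow>\<^sub>L 'h) set \<Rightarrow> bool" where
  "von_neumann_algebra M \<longleftrightarrow>
     M \<subseteq> bounded_ops \<and> (\<forall>x\<in>M. op_adjoint x \<in> M) \<and> commutant (commutant M) = M"

text \<open>The coarsest topology on \<open>S\<close> making all maps \<open>f i\<close>, \<open>i \<in> I\<close>, continuous into \<open>T\<close>.\<close>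

definition initial_topology ::
    "'a set \<Rightarrow> 'i set \<Rightarrow> ('i \<Rightarrow> 'a \<Rightarrow> 'b) \<Rightarrow> 'b topology \<Rightarrow> 'a topology" where
  "initial_topology S I f T =
     topology_generated_by (insert S {{x \<in> S. f i x \<in> U} |i U. i \<in> I \<and> openin T U})"

text \<open>The topology of the metric \<open>d\<close> on \<open>S\<close>. The locale \<^locale>\<open>Metric_space\<close> wants nonnegativity and
  symmetry of the distance on the whole type, hence the value 0 off \<open>S\<close>.\<close>

definition metric_topology :: "'a set \<Rightarrow> ('a \<Rightarrow> 'a \<Rightarrow> real) \<Rightarrow> 'a topology" where
  "metric_topology S d = Metric_space.mtopology S (\<lambda>x y. if x \<in> S \<and> y \<in> S then d x y else 0)"

definition ultraweak_topology :: "('h::chilbert_space \<Rightarrow>\<^sub>L 'h) set \<Rightarrow> ('h \<Rightarrow>\<^sub>L 'h) topology" where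
  "ultraweak_topology M =
     initial_topology M
       {(\<xi>, \<eta>). summable (\<lambda>n::nat. (norm (\<xi> n))\<^sup>2) \<and> summable (\<lambda>n::nat. (norm (\<eta> n))\<^sup>2)}
       (\<lambda>(\<xi>, \<eta>) (x :: 'h \<Rightarrow>\<^sub>L 'h). \<Sum>n. cinner (\<xi> n) (x (\<eta> n))) euclidean"

definition linear_functional_on ::
    "('h::chilbert_space \<Rightarrow>\<^sub>L 'h) set \<Rightarrow> (('h \<Rightarrow>\<^sub>L 'h) \<Rightarrow> complex) \<Rightarrow> bool" where
  "linear_functional_on M \<omega> \<longleftrightarrow>
     (\<forall>x\<in>M. \<forall>y\<in>M. \<omega> (x + y) = \<omega> x + \<omega> y) \<and> (\<forall>c. \<forall>x\<in>M. \<omega> (op_scale c x) = c * \<omega> x)"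

text \<open>The predual is the space of normal (i.e. ultraweakly continuous) linear functionals, with the
  norm of the dual space. Functions on \<open>M\<close> are represented by functions with value \<open>undefined\<close>
  off \<open>M\<close>, so that equality of functions is equality on \<open>M\<close>.\<close>

definition predual :: "('h::chilbert_space \<Rightarrow>\<^sub>L 'h) set \<Rightarrow> (('h \<Rightarrow>\<^sub>L 'h) \<Rightarrow> complex) set" where
  "predual M = {\<omega> \<in> extensional M.
     linear_functional_on M \<omega> \<and> continuous_map (ultraweak_topology M) euclidean \<omega>}"

definition functional_norm ::
    "('h::chilbert_space \<Rightarrow>\<^sub>L 'h) set \<Rightarrow> (('h \<Rightarrow>\<^sub>L 'h) \<Rightarrow> complex) \<Rightarrow> real" where
  "functional_norm M \<omega> = (SUP x\<in>{x \<in> M. norm x \<le> 1}. cmod (\<omega> x))"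

definition separable_predual :: "('h::chilbert_space \<Rightarrow>\<^sub>L 'h) set \<Rightarrow> bool" where
  "separable_predual M \<longleftrightarrow>
     separable_space (metric_topology (predual M)
       (\<lambda>\<omega> \<omega>'. functional_norm M (\<lambda>x. \<omega> x - \<omega>' x)))"

definition faithful_normal_state ::
    "('h::chilbert_space \<Rightarrow>\<^sub>L 'h) set \<Rightarrow> (('h \<Rightarrow>\<^sub>L 'h) \<Rightarrow> complex) \<Rightarrow> bool" where
  "faithful_normal_state M \<phi> \<longleftrightarrow>
     linear_functional_on M \<phi> \<and>
     (\<forall>x\<in>M. positive_op x \<longrightarrow> \<phi> x \<in> \<real>\<^sub>\<ge>\<^sub>0) \<and>
     \<phi> id_blinfun = 1 \<and>
     continuous_map (ultraweak_topology M) euclidean \<phi> \<and>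
     (\<forall>x\<in>M. positive_op x \<and> \<phi> x = 0 \<longrightarrow> x = 0)"

section \<open>The GNS representation and the strong topology\<close>

text \<open>\<open>gns_space N \<psi>\<close> is the Hilbert space completion of \<open>N\<close> for the inner product
  \<open>(x, y) \<mapsto> \<psi> (x\<^sup>* y)\<close>, realised as Cauchy sequences in \<open>N\<close> modulo null sequences;
  \<open>gns_action\<close> extends left multiplication of \<open>N\<close> on itself. The definitions by representatives
  do not depend on the choice, left multiplication by \<open>x\<close> being bounded by the operator norm
  of \<open>x\<close>.\<close>

definition gns_norm :: "(('k::chilbert_space \<Rightarrow>\<^sub>L 'k) \<Rightarrow> complex) \<Rightarrow> ('k \<Rightarrow>\<^sub>L 'k) \<Rightarrow> real" where
  "gns_norm \<psi> x = sqrt (Re (\<psi> (op_adjoint x o\<^sub>L x)))"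

definition gns_Cauchy ::
    "('k::chilbert_space \<Rightarrow>\<^sub>L 'k) set \<Rightarrow> (('k \<Rightarrow>\<^sub>L 'k) \<Rightarrow> complex) \<Rightarrow> (nat \<Rightarrow> ('k \<Rightarrow>\<^sub>L 'k)) set" where
  "gns_Cauchy N \<psi> = {y. range y \<subseteq> N \<and>
     (\<forall>e>0. \<exists>m. \<forall>i\<ge>m. \<forall>j\<ge>m. gns_norm \<psi> (y i - y j) < e)}"

definition gns_rel ::
    "('k::chilbert_space \<Rightarrow>\<^sub>L 'k) set \<Rightarrow> (('k \<Rightarrow>\<^sub>L 'k) \<Rightarrow> complex) \<Rightarrow> (nat \<Rightarrow> ('k \<Rightarrow>\<^sub>L 'k)) rel" where
  "gns_rel N \<psi> = {(y, z). y \<in> gns_Cauchy N \<psi> \<and> z \<in> gns_Cauchy N \<psi> \<and>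
     (\<lambda>n. gns_norm \<psi> (y n - z n)) \<longlonglongrightarrow> 0}"

definition gns_space ::
    "('k::chilbert_space \<Rightarrow>\<^sub>L 'k) set \<Rightarrow> (('k \<Rightarrow>\<^sub>L 'k) \<Rightarrow> complex) \<Rightarrow> (nat \<Rightarrow> ('k \<Rightarrow>\<^sub>L 'k)) set set" where
  "gns_space N \<psi> = gns_Cauchy N \<psi> // gns_rel N \<psi>"

definition gns_dist ::
    "(('k::chilbert_space \<Rightarrow>\<^sub>L 'k) \<Rightarrow> complex) \<Rightarrow>
      (nat \<Rightarrow> ('k \<Rightarrow>\<^sub>L 'k)) set \<Rightarrow> (nat \<Rightarrow> ('k \<Rightarrow>\<^sub>L 'k)) set \<Rightarrow> real" where
  "gns_dist \<psi> \<xi> \<eta> = lim (\<lambda>n. gns_norm \<psi> ((SOME y. y \<in> \<xi>) n - (SOME z. z \<in> \<eta>) n))"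

definition gns_action ::
    "('k::chilbert_space \<Rightarrow>\<^sub>L 'k) set \<Rightarrow> (('k \<Rightarrow>\<^sub>L 'k) \<Rightarrow> complex) \<Rightarrow>
      ('k \<Rightarrow>\<^sub>L 'k) \<Rightarrow> (nat \<Rightarrow> ('k \<Rightarrow>\<^sub>L 'k)) set \<Rightarrow> (nat \<Rightarrow> ('k \<Rightarrow>\<^sub>L 'k)) set" where
  "gns_action N \<psi> x \<xi> = gns_rel N \<psi> `` {\<lambda>n. x o\<^sub>L (SOME y. y \<in> \<xi>) n}"

definition strong_topology ::
    "('k::chilbert_space \<Rightarrow>\<^sub>L 'k) set \<Rightarrow> (('k \<Rightarrow>\<^sub>L 'k) \<Rightarrow> complex) \<Rightarrow> ('k \<Rightarrow>\<^sub>L 'k) topology" where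
  "strong_topology N \<psi> =
     initial_topology N (gns_space N \<psi>) (\<lambda>\<xi> x. gns_action N \<psi> x \<xi>)
       (metric_topology (gns_space N \<psi>) (gns_dist \<psi>))"

section \<open>State-preserving ucp maps\<close>

definition ucp_map ::
    "('h::chilbert_space \<Rightarrow>\<^sub>L 'h) set \<Rightarrow> ('k::chilbert_space \<Rightarrow>\<^sub>L 'k) set \<Rightarrow>
      (('h \<Rightarrow>\<^sub>L 'h) \<Rightarrow> ('k \<Rightarrow>\<^sub>L 'k)) \<Rightarrow> bool" where
  "ucp_map M N \<Phi> \<longleftrightarrow>
     \<Phi> \<in> M \<rightarrow>\<^sub>E N \<and>
     (\<forall>x\<in>M. \<forall>y\<in>M. \<Phi> (x + y) = \<Phi> x + \<Phi> y) \<and>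
     (\<forall>c. \<forall>x\<in>M. \<Phi> (op_scale c x) = op_scale c (\<Phi> x)) \<and>
     \<Phi> id_blinfun = id_blinfun \<and>
     (\<forall>n x. (\<forall>i<n. \<forall>j<n. x i j \<in> M) \<and> positive_matrix n x \<longrightarrow>
        positive_matrix n (\<lambda>i j. \<Phi> (x i j)))"

definition state_preserving_ucp_maps ::
    "('h::chilbert_space \<Rightarrow>\<^sub>L 'h) set \<Rightarrow> (('h \<Rightarrow>\<^sub>L 'h) \<Rightarrow> complex) \<Rightarrow>
      ('k::chilbert_space \<Rightarrow>\<^sub>L 'k) set \<Rightarrow> (('k \<Rightarrow>\<^sub>L 'k) \<Rightarrow> complex) \<Rightarrow>
      (('h \<Rightarrow>\<^sub>L 'h) \<Rightarrow> ('k \<Rightarrow>\<^sub>L 'k)) set" where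
  "state_preserving_ucp_maps M \<phi> N \<psi> = {\<Phi>. ucp_map M N \<Phi> \<and> (\<forall>x\<in>M. \<psi> (\<Phi> x) = \<phi> x)}"

definition pointwise_strong_topology ::
    "('h::chilbert_space \<Rightarrow>\<^sub>L 'h) set \<Rightarrow> (('h \<Rightarrow>\<^sub>L 'h) \<Rightarrow> complex) \<Rightarrow>
      ('k::chilbert_space \<Rightarrow>\<^sub>L 'k) set \<Rightarrow> (('k \<Rightarrow>\<^sub>L 'k) \<Rightarrow> complex) \<Rightarrow>
      (('h \<Rightarrow>\<^sub>L 'h) \<Rightarrow> ('k \<Rightarrow>\<^sub>L 'k)) topology" where
  "pointwise_strong_topology M \<phi> N \<psi> =
     initial_topology (state_preserving_ucp_maps M \<phi> N \<psi>) M (\<lambda>x \<Phi>. \<Phi> x) (strong_topology N \<psi>)"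

definition Polish_topology :: "'a topology \<Rightarrow> bool" where
  "Polish_topology X \<longleftrightarrow> separable_space X \<and> completely_metrizable_space X"

end

theory Submission
  imports Defs
begin

text \<open>
  A state-preserving ucp map \<open>\<Phi>\<close> satisfies \<open>\<parallel>\<Phi>(x)\<parallel> \<le> \<parallel>x\<parallel>\<close> and, by the Kadison--Schwarz inequality
  \<open>\<Phi>(x)\<^sup>*\<Phi>(x) \<le> \<Phi>(x\<^sup>* x)\<close>, also \<open>\<parallel>\<Phi>(x)\<parallel>\<^sub>\<psi> \<le> \<parallel>x\<parallel>\<^sub>\<phi>\<close> for the GNS norms
  \<open>\<parallel>y\<parallel>\<^sub>\<psi> = \<psi>(y\<^sup>* y)\<^sup>1\<^sup>/\<^sup>2\<close> (\<open>ucp_norm_le\<close>, \<open>ucp_gnorm_le\<close>). The maps are thus uniformly Lipschitz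
  for the GNS norms. If \<open>D\<close> is a countable subset of \<open>M\<close>, dense for \<open>\<parallel>\<cdot>\<parallel>\<^sub>\<phi>\<close>, then \<open>\<Phi>\<close> is determined
  by its restriction to \<open>D\<close>, which is a point of the product over \<open>d \<in> D\<close> of the operator norm balls
  of \<open>N\<close> of radius \<open>\<parallel>d\<parallel>\<close>. Such a \<open>D\<close> exists because the predual is separable: a ball of \<open>M\<close> embeds
  into the predual by \<open>x \<mapsto> \<phi>(x\<^sup>* \<cdot>)\<close> (\<open>separable_gnorm\<close>).

  With the metric \<open>\<parallel>x - y\<parallel>\<^sub>\<psi>\<close> these balls are complete (\<open>mcomplete_oball\<close>), and on them this metric
  gives the strong topology (\<open>gns_action_continuous_on_bounded\<close>, \<open>strong_topology_ball_nhd\<close>).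
  Restriction to \<open>D\<close> is therefore a homeomorphism of the space of maps onto a subspace of a countable
  product of complete metric spaces (\<open>restriction_homeomorphism\<close>). The subspace is closed
  (\<open>closedin_restricted_maps\<close>), so that it is completely metrizable, and it is separable because the
  balls of \<open>N\<close> are (\<open>separable_pointwise_strong\<close>).

  The analytic input is one compactness principle: a bounded net in a von Neumann algebra has a weak
  operator cluster point in the algebra, along a finer filter that serves any number of nets
  simultaneously (\<open>bounded_ops_wot_convergent_subfilter\<close>). Ultraweakly continuous functionals respect
  such bounded limits, and the GNS norm is lower semicontinuous for them. This yields the completeness
  of the balls, the comparison of the two topologies (where faithfulness of \<open>\<psi>\<close> identifies a cluster
  point with 0), the boundedness of normal functionals, and the closedness of the set of maps, because
  complete positivity and preservation of the state pass to weak limits.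
\<close>

section \<open>Bounded operators on a complex Hilbert space\<close>

text \<open>The Cauchy--Schwarz inequality for a possibly degenerate form, given by its values
  \<open>p = s(x, x)\<close>, \<open>u = s(x, y)\<close>, \<open>v = s(y, x)\<close>, \<open>q = s(y, y)\<close>. It serves for the inner product of the
  Hilbert space, for the form \<open>\<psi>(x\<^sup>* y)\<close>, and for the form of a positive operator matrix.\<close>

lemma nonneg_quadratic_form:
  fixes p u v q :: complex
  assumes nonneg: "\<And>c. p + c * u + cnj c * v + c * cnj c * q \<in> \<real>\<^sub>\<ge>\<^sub>0"
    and q: "q \<in> \<real>\<^sub>\<ge>\<^sub>0"
  shows "v = cnj u" and "(cmod u)\<^sup>2 \<le> Re p * Re q"
proof -
  have p: "p \<in> \<real>\<^sub>\<ge>\<^sub>0"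
    using nonneg[of 0] by simp
  have "Im (u + v) = 0" "Re u = Re v"
    using nonneg[of 1] nonneg[of \<i>] p q by (auto simp: complex_nonneg_Reals_iff algebra_simps)
  then show v: "v = cnj u"
    by (simp add: complex_eq_iff)
  \<comment> \<open>The value of the form at \<open>c = - t \<cdot> cnj u\<close>; \<open>t = 1 / q\<close> is optimal, and if \<open>q = 0\<close> a large \<open>t\<close>
    forces \<open>u = 0\<close>.\<close>
  have ineq: "0 \<le> Re p - 2 * t * (cmod u)\<^sup>2 + t\<^sup>2 * (cmod u)\<^sup>2 * Re q" for t :: real
  proof -
    define c where "c = - of_real t * cnj u"
    have "cnj c * v = - of_real t * (u * cnj u)" "c * u = - of_real t * (u * cnj u)"
        "c * cnj c = of_real (t\<^sup>2) * (u * cnj u)"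
      unfolding c_def v by (simp_all add: power2_eq_square)
    then have "Re (p + c * u + cnj c * v + c * cnj c * q)
        = Re p - 2 * t * (cmod u)\<^sup>2 + t\<^sup>2 * (cmod u)\<^sup>2 * Re q"
      by (simp add: complex_norm_square [symmetric] del: of_real_power)
    then show ?thesis
      using nonneg[of c] by (simp add: complex_nonneg_Reals_iff)
  qed
  show "(cmod u)\<^sup>2 \<le> Re p * Re q"
  proof (cases "Re q = 0")
    case True
    have "u = 0"
    proof (rule ccontr)
      assume "u \<noteq> 0"
      then have "0 \<le> Re p - 2 * (Re p + 1)"
        using ineq[of "(Re p + 1) / (cmod u)\<^sup>2"] True by simp
      then show False
        using p by (simp add: complex_nonneg_Reals_iff)
    qed
    then show ?thesis
      using True by simp
  next
    case False
    then have "0 < Re q"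
      using q by (simp add: complex_nonneg_Reals_iff)
    then show ?thesis
      using ineq[of "1 / Re q"] by (simp add: power2_eq_square field_simps)
  qed
qed

lemma cinner_scaleC_left: "cinner (scaleC a x) y = cnj a * cinner x y"
  by (metis cinner_commute cinner_scaleC_right complex_cnj_mult)

lemma cinner_add_left: "cinner (x + y) z = cinner x z + cinner y z"
  by (metis cinner_commute cinner_add_right complex_cnj_add)

lemma cinner_self: "cinner x x = complex_of_real ((norm x)\<^sup>2)"
proof -
  have "0 \<le> Re (cinner x x)"
    using norm_ge_zero[of x] unfolding norm_eq_sqrt_cinner by simp
  moreover have "Im (cinner x x) = 0"
    using arg_cong[OF cinner_commute[of x x], of Im] by simp
  ultimately show ?thesis
    by (simp add: complex_eq_iff norm_eq_sqrt_cinner)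
qed

lemma cinner_Cauchy_Schwarz: "cmod (cinner x y) \<le> norm x * norm (y :: 'h::chilbert_space)"
proof -
  have "cinner x x + c * cinner x y + cnj c * cinner y x + c * cnj c * cinner y y \<in> \<real>\<^sub>\<ge>\<^sub>0" for c
  proof -
    have "cinner x x + c * cinner x y + cnj c * cinner y x + c * cnj c * cinner y y
        = cinner (x + scaleC c y) (x + scaleC c y)"
      by (simp add: cinner_add_left cinner_add_right cinner_scaleC_left cinner_scaleC_right
          algebra_simps)
    then show ?thesis
      by (simp add: cinner_self)
  qed
  from nonneg_quadratic_form(2)[OF this] have "(cmod (cinner x y))\<^sup>2 \<le> (norm x * norm y)\<^sup>2"
    by (simp add: cinner_self power_mult_distrib)
  then show ?thesis
    by (rule power2_le_imp_le) simp
qed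

interpretation cinner: bounded_bilinear "cinner :: 'h::chilbert_space \<Rightarrow> 'h \<Rightarrow> complex"
proof
  show "\<exists>K. \<forall>(x :: 'h) y. cmod (cinner x y) \<le> norm x * norm y * K"
    by (intro exI[of _ 1]) (simp add: cinner_Cauchy_Schwarz)
qed (simp_all add: cinner_add_left cinner_add_right scaleR_eq_scaleC cinner_scaleC_left
    cinner_scaleC_right scaleR_conv_of_real)

lemma norm_scaleC: "norm (scaleC c x) = cmod c * norm (x :: 'h::chilbert_space)"
proof -
  have "complex_of_real ((norm (scaleC c x))\<^sup>2) = (c * cnj c) * cinner x x"
    unfolding cinner_self [symmetric] by (simp add: cinner_scaleC_left cinner_scaleC_right)
  also have "\<dots> = complex_of_real ((cmod c * norm x)\<^sup>2)"
    by (simp add: cinner_self power_mult_distrib complex_norm_square [symmetric])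
  finally have "(norm (scaleC c x))\<^sup>2 = (cmod c * norm x)\<^sup>2"
    using of_real_eq_iff by blast
  then show ?thesis
    by (simp add: power2_eq_iff_nonneg)
qed

lemma scaleC_scaleR: "scaleC c (r *\<^sub>R x) = r *\<^sub>R scaleC c (x :: 'h::chilbert_space)"
  by (simp add: scaleR_eq_scaleC scaleC_scaleC mult.commute)

lemma cinner_ext_right:
  assumes "\<And>\<xi>. cinner \<xi> x = cinner \<xi> (y :: 'h::chilbert_space)"
  shows "x = y"
proof -
  have "cinner (x - y) (x - y) = 0"
    using assms[of "x - y"] by (simp add: cinner.diff_right)
  then show ?thesis
    by (simp add: cinner_self)
qed

lemma norm_eq_cinner_bound:
  assumes "\<And>\<xi>. cmod (cinner \<xi> x) \<le> C * norm \<xi>" and "0 \<le> C"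
  shows "norm (x :: 'h::chilbert_space) \<le> C"
proof (cases "x = 0")
  case False
  have "norm x * norm x \<le> C * norm x"
    using assms(1)[of x] by (simp add: cinner_self power2_eq_square norm_mult)
  then show ?thesis
    using False by simp
qed (use assms in simp)

lemma norm_add_square:
  "(norm (x + y))\<^sup>2 = (norm x)\<^sup>2 + 2 * Re (cinner x y) + (norm (y :: 'h::chilbert_space))\<^sup>2"
proof -
  have "Re (cinner y x) = Re (cinner x y)"
    by (subst cinner_commute) simp
  moreover have "(norm (x + y))\<^sup>2 = Re (cinner (x + y) (x + y))"
    by (simp add: cinner_self)
  moreover have "cinner (x + y) (x + y) = cinner x x + cinner x y + cinner y x + cinner y y"
    by (simp add: cinner.add_left cinner.add_right)
  ultimately show ?thesis
    using cinner_self[of x] cinner_self[of y]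
    by (metis (no_types, lifting) Re_complex_of_real add.assoc cinner_self mult_2 plus_complex.sel(1))
qed

text \<open>The representing vector is the minimiser of \<open>J \<xi> = \<parallel>\<xi>\<parallel>\<^sup>2 - 2 Re (f \<xi>)\<close>: by the parallelogram
  law a minimising sequence is Cauchy, and the vanishing of the first variation of \<open>J\<close> at the
  minimiser \<open>z\<close> says \<open>Re \<langle>z, \<xi>\<rangle> = Re (f \<xi>)\<close>. Replacing \<open>\<xi>\<close> by \<open>i \<xi>\<close> gives the imaginary parts.\<close>

lemma Riesz_representation:
  fixes f :: "'h::chilbert_space \<Rightarrow> complex"
  assumes add: "\<And>\<xi> \<eta>. f (\<xi> + \<eta>) = f \<xi> + f \<eta>"
    and scale: "\<And>c \<xi>. f (scaleC c \<xi>) = c * f \<xi>"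
    and bound: "\<And>\<xi>. cmod (f \<xi>) \<le> C * norm \<xi>"
  shows "\<exists>z. \<forall>\<xi>. f \<xi> = cinner z \<xi>"
proof -
  define g where "g \<xi> = Re (f \<xi>)" for \<xi>
  have scaleR: "f (r *\<^sub>R \<xi>) = of_real r * f \<xi>" for r \<xi>
    by (simp add: scaleR_eq_scaleC scale)
  have g: "bounded_linear g"
  proof
    show "\<exists>K. \<forall>x. norm (g x) \<le> norm x * K"
      using bound abs_Re_le_cmod unfolding g_def
      by (intro exI[of _ C]) (auto intro: order_trans simp: mult.commute)
  qed (simp_all add: g_def add scaleR)
  interpret g: bounded_linear g
    by (rule g)
  define J where "J \<xi> = (norm \<xi>)\<^sup>2 - 2 * g \<xi>" for \<xi>
  have J_lower: "- C\<^sup>2 \<le> J \<xi>" for \<xi>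
  proof -
    have "g \<xi> \<le> C * norm \<xi>"
      using bound[of \<xi>] complex_Re_le_cmod[of "f \<xi>"] by (simp add: g_def)
    moreover have "0 \<le> (norm \<xi> - C)\<^sup>2"
      by simp
    ultimately show ?thesis
      unfolding J_def by (simp add: power2_diff algebra_simps)
  qed
  define m where "m = Inf (range J)"
  have bdd: "bdd_below (range J)"
    using J_lower by (intro bdd_belowI) auto
  have m_le: "m \<le> J \<xi>" for \<xi>
    unfolding m_def by (rule cInf_lower[OF _ bdd]) simp
  have "\<exists>\<xi>. J \<xi> < m + 1 / Suc n" for n
  proof (rule ccontr)
    assume "\<nexists>\<xi>. J \<xi> < m + 1 / Suc n"
    then have "m + 1 / Suc n \<le> m"
      unfolding m_def by (intro cInf_greatest) (auto simp: not_less)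
    then show False
      by simp
  qed
  then obtain s where s: "\<And>n. J (s n) < m + 1 / Suc n"
    by metis
  have parallelogram: "(norm (\<xi> - \<eta>))\<^sup>2 = 2 * J \<xi> + 2 * J \<eta> - 4 * J ((1/2) *\<^sub>R (\<xi> + \<eta>))" for \<xi> \<eta>
  proof -
    have "(norm (\<xi> - \<eta>))\<^sup>2 + (norm (\<xi> + \<eta>))\<^sup>2 = 2 * (norm \<xi>)\<^sup>2 + 2 * (norm \<eta>)\<^sup>2"
      using norm_add_square[of \<xi> \<eta>] norm_add_square[of \<xi> "-\<eta>"] by (simp add: cinner.minus_right)
    moreover have "4 * J ((1/2) *\<^sub>R (\<xi> + \<eta>)) = (norm (\<xi> + \<eta>))\<^sup>2 - 4 * (g \<xi> + g \<eta>)"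
      unfolding J_def g.scaleR g.add norm_scaleR by (simp add: power_divide algebra_simps)
    ultimately show ?thesis
      unfolding J_def by simp
  qed
  have "Cauchy s"
  proof (rule metric_CauchyI)
    fix e :: real
    assume e: "0 < e"
    obtain n0 where n0: "4 / e\<^sup>2 < real n0"
      using reals_Archimedean2 by blast
    have "dist (s i) (s j) < e" if ij: "n0 \<le> i" "n0 \<le> j" for i j
    proof -
      have "1 / Suc i \<le> 1 / Suc n0" "1 / Suc j \<le> 1 / Suc n0"
        using ij by (simp_all add: frac_le)
      then have "(norm (s i - s j))\<^sup>2 < 4 / Suc n0"
        using parallelogram[of "s i" "s j"] s[of i] s[of j] m_le[of "(1/2) *\<^sub>R (s i + s j)"] by simp
      also have "4 / Suc n0 \<le> e\<^sup>2"
      proof -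
        have "0 < e\<^sup>2" using e by simp
        then have "4 \<le> e\<^sup>2 * real n0 + e\<^sup>2"
          using n0 by (simp add: field_simps add_increasing)
        then have "4 \<le> e\<^sup>2 * real (Suc n0)"
          by (simp add: algebra_simps)
        then show ?thesis
          by (simp add: field_simps)
      qed
      finally show ?thesis
        using e by (simp add: dist_norm power_less_imp_less_base)
    qed
    then show "\<exists>M. \<forall>i\<ge>M. \<forall>j\<ge>M. dist (s i) (s j) < e"
      by blast
  qed
  then obtain z where z: "s \<longlonglongrightarrow> z"
    using Cauchy_convergent_iff convergent_def by blast
  have "(\<lambda>n. J (s n)) \<longlonglongrightarrow> J z"
    unfolding J_def by (intro tendsto_intros z g.tendsto)
  moreover have "(\<lambda>n. m + 1 / Suc n) \<longlonglongrightarrow> m + 0"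
    by (intro tendsto_intros LIMSEQ_Suc[OF lim_1_over_n])
  ultimately have "J z \<le> m + 0"
    using s by (intro LIMSEQ_le) (auto intro: less_imp_le)
  then have min: "J z \<le> J \<xi>" for \<xi>
    using m_le[of \<xi>] by simp
  have Re_eq: "Re (cinner z \<xi>) = Re (f \<xi>)" for \<xi>
  proof -
    define a where "a = Re (cinner z \<xi>) - g \<xi>"
    have "0 \<le> 2 * t * a + t\<^sup>2 * (norm \<xi>)\<^sup>2" for t :: real
      using min[of "z + t *\<^sub>R \<xi>"] norm_add_square[of z "t *\<^sub>R \<xi>"]
      unfolding J_def a_def
      by (simp add: g.add g.scaleR cinner.scaleR_right power_mult_distrib algebra_simps)
    note variation = this
    \<comment> \<open>A step of size \<open>a / \<parallel>\<xi>\<parallel>\<^sup>2\<close> would be optimal; \<open>D\<close> avoids a separate case \<open>\<xi> = 0\<close>.\<close>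
    define D where "D = (norm \<xi>)\<^sup>2 + 1"
    have D: "0 < D" "(norm \<xi>)\<^sup>2 = D - 1"
      unfolding D_def by (simp_all add: add_nonneg_pos)
    have "0 \<le> (2 * (- a / D) * a + (- a / D)\<^sup>2 * (D - 1)) * D\<^sup>2"
      using variation[of "- a / D"] D by simp
    also have "\<dots> = - (a\<^sup>2 * (D + 1))"
      using D by (simp add: power2_eq_square field_simps)
    finally have "a\<^sup>2 \<le> 0"
      using D by (simp add: mult_le_0_iff)
    then show ?thesis
      unfolding a_def g_def by simp
  qed
  have "cinner z \<xi> = f \<xi>" for \<xi>
    using Re_eq[of \<xi>] Re_eq[of "scaleC \<i> \<xi>"]
    by (simp add: complex_eq_iff cinner_scaleC_right scale)
  then show ?thesis
    by metis
qed

lemma bounded_op_scaleC: "T \<in> bounded_ops \<Longrightarrow> blinfun_apply T (scaleC c \<xi>) = scaleC c (T \<xi>)"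
  by (simp add: bounded_ops_def)

lemma bounded_opI: "(\<And>c \<xi>. blinfun_apply T (scaleC c \<xi>) = scaleC c (T \<xi>)) \<Longrightarrow> T \<in> bounded_ops"
  by (simp add: bounded_ops_def)

lemma op_scale_apply [simp]: "blinfun_apply (op_scale c T) \<xi> = scaleC c (T \<xi>)"
proof -
  have "bounded_linear (\<lambda>\<xi>. scaleC c (blinfun_apply T \<xi>))"
  proof
    show "\<exists>K. \<forall>x. norm (scaleC c (blinfun_apply T x)) \<le> norm x * K"
    proof (intro exI allI)
      fix x
      show "norm (scaleC c (blinfun_apply T x)) \<le> norm x * (cmod c * norm T)"
        using mult_left_mono[OF norm_blinfun[of T x], of "cmod c"]
        by (simp add: norm_scaleC mult_ac)
    qed
    show "scaleC c (blinfun_apply T (r *\<^sub>R x)) = r *\<^sub>R scaleC c (blinfun_apply T x)" for r x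
      by (simp add: blinfun.scaleR_right scaleC_scaleR)
  qed (simp add: blinfun.add_right scaleC_add_right)
  then show ?thesis
    unfolding op_scale_def by (simp add: bounded_linear_Blinfun_apply)
qed

lemma op_scale_of_real: "op_scale (complex_of_real r) T = r *\<^sub>R T"
  by (rule blinfun_eqI) (simp add: scaleR_eq_scaleC blinfun.scaleR_left)

text \<open>The vector \<open>T \<eta>\<close> represents the functional \<open>\<xi> \<mapsto> cnj (B \<xi> \<eta>)\<close>. This provides both adjoints and
  weak limits of operators.\<close>

lemma bounded_operator_of_form:
  fixes B :: "'h::chilbert_space \<Rightarrow> 'h \<Rightarrow> complex"
  assumes add_left: "\<And>\<xi> \<xi>' \<eta>. B (\<xi> + \<xi>') \<eta> = B \<xi> \<eta> + B \<xi>' \<eta>"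
    and add_right: "\<And>\<xi> \<eta> \<eta>'. B \<xi> (\<eta> + \<eta>') = B \<xi> \<eta> + B \<xi> \<eta>'"
    and scale_left: "\<And>c \<xi> \<eta>. B (scaleC c \<xi>) \<eta> = cnj c * B \<xi> \<eta>"
    and scale_right: "\<And>c \<xi> \<eta>. B \<xi> (scaleC c \<eta>) = c * B \<xi> \<eta>"
    and bound: "\<And>\<xi> \<eta>. cmod (B \<xi> \<eta>) \<le> C * norm \<xi> * norm \<eta>" and "0 \<le> C"
  obtains T where "T \<in> bounded_ops" "\<And>\<xi> \<eta>. cinner \<xi> (blinfun_apply T \<eta>) = B \<xi> \<eta>" "norm T \<le> C"
proof -
  have "\<exists>z. \<forall>\<xi>. cnj (B \<xi> \<eta>) = cinner z \<xi>" for \<eta>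
    using add_left scale_left bound
    by (intro Riesz_representation[where C = "C * norm \<eta>"]) (simp_all add: mult_ac)
  then obtain t where "\<And>\<eta> \<xi>. cnj (B \<xi> \<eta>) = cinner (t \<eta>) \<xi>"
    by metis
  then have t: "cinner \<xi> (t \<eta>) = B \<xi> \<eta>" for \<xi> \<eta>
    by (metis cinner_commute complex_cnj_cnj)
  have t_add: "t (\<eta> + \<eta>') = t \<eta> + t \<eta>'" for \<eta> \<eta>'
    by (rule cinner_ext_right) (simp add: t add_right cinner.add_right)
  have t_scale: "t (scaleC c \<eta>) = scaleC c (t \<eta>)" for c \<eta>
    by (rule cinner_ext_right) (simp add: t scale_right cinner_scaleC_right)
  have t_norm: "norm (t \<eta>) \<le> C * norm \<eta>" for \<eta>
    using bound \<open>0 \<le> C\<close> by (intro norm_eq_cinner_bound) (simp_all add: t mult_ac)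
  have "bounded_linear t"
  proof
    show "\<exists>K. \<forall>x. norm (t x) \<le> norm x * K"
      using t_norm by (intro exI[of _ C]) (simp add: mult.commute)
  qed (simp_all add: t_add scaleR_eq_scaleC t_scale)
  then have apply_t: "blinfun_apply (Blinfun t) = t"
    by (rule bounded_linear_Blinfun_apply)
  show ?thesis
  proof (rule that[of "Blinfun t"])
    show "norm (Blinfun t) \<le> C"
      using t_norm \<open>0 \<le> C\<close> by (intro norm_blinfun_bound) (simp_all add: apply_t)
  qed (auto intro: bounded_opI simp: apply_t t t_scale)
qed

lemma op_adjoint:
  assumes T: "T \<in> bounded_ops"
  shows "cinner (op_adjoint T \<xi>) \<eta> = cinner \<xi> (T \<eta>)" and "op_adjoint T \<in> bounded_ops"
proof -
  have bound: "cmod (cinner (T \<xi>) \<eta>) \<le> norm T * norm \<xi> * norm \<eta>" for \<xi> \<eta>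
    using cinner_Cauchy_Schwarz[of "T \<xi>" \<eta>] mult_right_mono[OF norm_blinfun[of T \<xi>], of "norm \<eta>"]
    by simp
  obtain S where S: "S \<in> bounded_ops" "\<And>\<xi> \<eta>. cinner \<xi> (blinfun_apply S \<eta>) = cinner (T \<xi>) \<eta>"
    by (rule bounded_operator_of_form[of "\<lambda>\<xi> \<eta>. cinner (T \<xi>) \<eta>", OF _ _ _ _ bound])
      (auto simp: blinfun.add_right cinner.add_left cinner.add_right bounded_op_scaleC[OF T]
        cinner_scaleC_left cinner_scaleC_right)
  have adj: "\<forall>\<xi> \<eta>. cinner (S \<xi>) \<eta> = cinner \<xi> (T \<eta>)"
    using S(2) by (metis cinner_commute)
  moreover have "S' = S" if "\<forall>\<xi> \<eta>. cinner (blinfun_apply S' \<xi>) \<eta> = cinner \<xi> (T \<eta>)" for S'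
    by (rule blinfun_eqI, rule cinner_ext_right) (metis that adj cinner_commute)
  ultimately have "op_adjoint T = S"
    unfolding op_adjoint_def by (intro the_equality)
  then show "cinner (op_adjoint T \<xi>) \<eta> = cinner \<xi> (T \<eta>)" "op_adjoint T \<in> bounded_ops"
    using adj S by auto
qed

lemma op_adjoint_right:
  "T \<in> bounded_ops \<Longrightarrow> cinner \<xi> (op_adjoint T \<eta>) = cinner (T \<xi>) \<eta>"
  by (metis op_adjoint(1) cinner_commute)

lemma op_eqI:
  assumes "\<And>\<xi> \<eta>. cinner \<xi> (blinfun_apply S \<eta>) = cinner \<xi> (blinfun_apply T \<eta>)"
  shows "S = T"
  using assms by (intro blinfun_eqI cinner_ext_right) auto

lemma norm_op_le:
  assumes "\<And>\<xi> \<eta>. cmod (cinner \<xi> (blinfun_apply T \<eta>)) \<le> C * norm \<xi> * norm \<eta>" and "0 \<le> C"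
  shows "norm (T :: 'h::chilbert_space \<Rightarrow>\<^sub>L 'h) \<le> C"
proof (rule norm_blinfun_bound)
  show "norm (T \<eta>) \<le> C * norm \<eta>" for \<eta>
    using assms(1)[of _ \<eta>] \<open>0 \<le> C\<close> by (intro norm_eq_cinner_bound) (simp_all add: mult_ac)
qed fact

lemma cmod_cinner_op_le:
  "cmod (cinner \<xi> (blinfun_apply T \<eta>)) \<le> norm T * norm \<xi> * norm (\<eta> :: 'h::chilbert_space)"
  using cinner_Cauchy_Schwarz[of \<xi> "T \<eta>"] mult_left_mono[OF norm_blinfun[of T \<eta>], of "norm \<xi>"]
  by (simp add: mult_ac)

lemma norm_op_adjoint_le:
  assumes "T \<in> bounded_ops"
  shows "norm (op_adjoint T) \<le> norm T"
proof (rule norm_op_le)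
  show "cmod (cinner \<xi> (blinfun_apply (op_adjoint T) \<eta>)) \<le> norm T * norm \<xi> * norm \<eta>" for \<xi> \<eta>
    using cmod_cinner_op_le[of \<eta> T \<xi>] assms
    by (subst cinner_commute) (simp add: op_adjoint mult.assoc mult.commute[of "norm \<xi>"])
qed simp

lemma op_adjoint_add:
  assumes "x \<in> bounded_ops" "y \<in> bounded_ops" "x + y \<in> bounded_ops"
  shows "op_adjoint (x + y) = op_adjoint x + op_adjoint y"
  using assms by (intro op_eqI)
    (simp add: op_adjoint_right blinfun.add_left cinner.add_left cinner.add_right)

lemma op_adjoint_compose:
  assumes "x \<in> bounded_ops" "y \<in> bounded_ops" "x o\<^sub>L y \<in> bounded_ops"
  shows "op_adjoint (x o\<^sub>L y) = op_adjoint y o\<^sub>L op_adjoint x"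
  using assms by (intro op_eqI) (simp add: op_adjoint_right)

lemma compose_id [simp]: "x o\<^sub>L id_blinfun = x" "id_blinfun o\<^sub>L x = x"
  by (auto intro: blinfun_eqI)

lemma positive_adjoint_compose: "x \<in> bounded_ops \<Longrightarrow> positive_op (op_adjoint x o\<^sub>L x)"
  by (simp add: positive_op_def op_adjoint_right cinner_self)

section \<open>Von Neumann algebras\<close>

locale von_neumann =
  fixes N :: "('h::chilbert_space \<Rightarrow>\<^sub>L 'h) set"
  assumes von_neumann_algebra: "von_neumann_algebra N"
begin

lemma bounded_op: "x \<in> N \<Longrightarrow> x \<in> bounded_ops"
  using von_neumann_algebra by (auto simp: von_neumann_algebra_def)

lemma mem_iff_commutes:
  "x \<in> N \<longleftrightarrow> x \<in> bounded_ops \<and> (\<forall>A\<in>commutant N. \<forall>\<xi>. x (blinfun_apply A \<xi>) = A (x \<xi>))"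
proof -
  have "x \<in> N \<longleftrightarrow> x \<in> commutant (commutant N)"
    using von_neumann_algebra by (simp add: von_neumann_algebra_def)
  also have "\<dots> \<longleftrightarrow> x \<in> bounded_ops \<and> (\<forall>A\<in>commutant N. x o\<^sub>L A = A o\<^sub>L x)"
    by (simp add: commutant_def)
  also have "\<dots> \<longleftrightarrow> x \<in> bounded_ops \<and> (\<forall>A\<in>commutant N. \<forall>\<xi>. x (blinfun_apply A \<xi>) = A (x \<xi>))"
    by (metis blinfun_apply_blinfun_compose blinfun_eqI)
  finally show ?thesis .
qed

lemma commutant_bounded_op: "A \<in> commutant N \<Longrightarrow> A \<in> bounded_ops"
  by (simp add: commutant_def)

lemma add_mem: "x \<in> N \<Longrightarrow> y \<in> N \<Longrightarrow> x + y \<in> N"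
  by (auto simp: mem_iff_commutes blinfun.add_left blinfun.add_right bounded_op_scaleC
      scaleC_add_right intro!: bounded_opI)

lemma op_scale_mem: "x \<in> N \<Longrightarrow> op_scale c x \<in> N"
  by (auto simp: mem_iff_commutes bounded_op_scaleC[OF commutant_bounded_op] bounded_op_scaleC
      scaleC_scaleC mult.commute intro!: bounded_opI)

lemma scaleR_mem: "x \<in> N \<Longrightarrow> r *\<^sub>R x \<in> N"
  using op_scale_mem[of x "of_real r"] by (simp add: op_scale_of_real)

lemma diff_mem: "x \<in> N \<Longrightarrow> y \<in> N \<Longrightarrow> x - y \<in> N"
  using add_mem[of x "(-1) *\<^sub>R y"] scaleR_mem[of y "-1"] by simp

lemma compose_mem: "x \<in> N \<Longrightarrow> y \<in> N \<Longrightarrow> x o\<^sub>L y \<in> N"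
  by (auto simp: mem_iff_commutes bounded_op_scaleC intro!: bounded_opI)

lemma id_mem: "id_blinfun \<in> N"
  by (auto simp: mem_iff_commutes intro!: bounded_opI)

lemma zero_mem: "0 \<in> N"
  using diff_mem[OF id_mem id_mem] by simp

lemma adjoint_mem: "x \<in> N \<Longrightarrow> op_adjoint x \<in> N"
  using von_neumann_algebra by (simp add: von_neumann_algebra_def)

lemma op_adjoint_diff:
  assumes "x \<in> N" "y \<in> N"
  shows "op_adjoint (x - y) = op_adjoint x - op_adjoint y"
  using op_adjoint_add[of "x - y" y] assms diff_mem[OF assms]
  by (simp add: bounded_op)

end

section \<open>Initial topologies\<close>

lemma limitin_initial_topology:
  assumes l: "l \<in> S" and ev: "\<forall>\<^sub>F a in F. x a \<in> S"
    and lim: "\<And>i. i \<in> I \<Longrightarrow> limitin T (\<lambda>a. f i (x a)) (f i l) F"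
  shows "limitin (initial_topology S I f T) x l F"
proof -
  define \<B> where "\<B> = insert S {{y \<in> S. f i y \<in> U} |i U. i \<in> I \<and> openin T U}"
  have "l \<in> U \<longrightarrow> (\<forall>\<^sub>F a in F. x a \<in> U)" if "generate_topology_on \<B> U" for U
    using that
  proof induction
    case (Int U V)
    then show ?case
      by (auto intro: eventually_conj)
  next
    case (UN K)
    show ?case
    proof
      assume "l \<in> \<Union>K"
      then obtain k where "k \<in> K" "\<forall>\<^sub>F a in F. x a \<in> k"
        using UN by blast
      then show "\<forall>\<^sub>F a in F. x a \<in> \<Union>K"
        by (auto elim: eventually_mono)
    qed
  next
    case (Basis U)
    then consider "U = S" | i V where "i \<in> I" "openin T V" "U = {y \<in> S. f i y \<in> V}"
      unfolding \<B>_def by blast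
    then show ?case
    proof cases
      case 2
      then show ?thesis
        using lim[OF 2(1)] ev by (auto simp: limitin_def elim: eventually_elim2)
    qed (use ev in simp)
  qed simp
  moreover have "l \<in> topspace (topology_generated_by \<B>)"
    using l by (auto simp: topology_generated_by_topspace \<B>_def)
  ultimately show ?thesis
    unfolding initial_topology_def \<B>_def[symmetric] limitin_def
    by (auto simp: openin_topology_generated_by_iff)
qed

lemma initial_topology_continuous_map_into:
  assumes "g \<in> topspace X \<rightarrow> S" and "\<And>i. i \<in> I \<Longrightarrow> continuous_map X T (\<lambda>t. f i (g t))"
  shows "continuous_map X (initial_topology S I f T) g"
  unfolding initial_topology_def
proof (rule continuous_on_generated_topo)
  fix U
  assume "U \<in> insert S {{x \<in> S. f i x \<in> U} |i U. i \<in> I \<and> openin T U}"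
  then consider "U = S" | i V where "i \<in> I" "openin T V" "U = {x \<in> S. f i x \<in> V}"
    by blast
  then show "openin X (g -` U \<inter> topspace X)"
  proof cases
    case 1
    then have "g -` U \<inter> topspace X = topspace X"
      using assms(1) by blast
    then show ?thesis
      by simp
  next
    case 2
    then have "g -` U \<inter> topspace X = {t \<in> topspace X. f i (g t) \<in> V}"
      using assms(1) by blast
    then show ?thesis
      using openin_continuous_map_preimage[OF assms(2)[OF 2(1)] 2(2)] by simp
  qed
qed (use assms(1) in blast)

lemma initial_topology_topspace: "topspace (initial_topology S I f T) = S"
  unfolding initial_topology_def topology_generated_by_topspace by blast

lemma initial_topology_continuous_map:
  assumes "i \<in> I" and "\<And>x. x \<in> S \<Longrightarrow> f i x \<in> topspace T"
  shows "continuous_map (initial_topology S I f T) T (f i)"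
proof -
  have "openin (initial_topology S I f T) {x \<in> S. f i x \<in> U}" if "openin T U" for U
    unfolding initial_topology_def using assms(1) that by (intro topology_generated_by_Basis) blast
  then show ?thesis
    using assms(2) by (auto simp: continuous_map_def initial_topology_topspace)
qed

section \<open>Weak operator limits\<close>

text \<open>The bounded functions \<open>a \<mapsto> b a i\<close> take values in discs, so that the family is a map into a
  compact product of discs. A cluster point of its image filter is a limit along a finer filter,
  which serves all indices \<open>i\<close> at once.\<close>

lemma bounded_family_convergent_subfilter:
  fixes b :: "'a \<Rightarrow> 'i \<Rightarrow> complex"
  assumes F: "F \<noteq> bot" and bound: "\<forall>\<^sub>F a in F. \<forall>i. cmod (b a i) \<le> C i"
  obtains G l where "G \<le> F" "G \<noteq> bot" "\<And>i. ((\<lambda>a. b a i) \<longlongrightarrow> l i) G"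
proof -
  define K where "K = (\<Pi>\<^sub>E i\<in>UNIV. cball (0::complex) (C i))"
  have "compactin (product_topology (\<lambda>i::'i. euclidean) UNIV) K"
    unfolding K_def by (simp add: compactin_PiE)
  then have "compact K"
    by (simp add: euclidean_product_topology)
  moreover have "filtermap b F \<noteq> bot"
    using F by (simp add: filtermap_bot_iff)
  moreover have "eventually (\<lambda>x. x \<in> K) (filtermap b F)"
    using bound by (simp add: eventually_filtermap K_def PiE_iff)
  ultimately obtain l where l: "inf (nhds l) (filtermap b F) \<noteq> bot"
    unfolding compact_filter by metis
  define G where "G = inf F (filtercomap b (nhds l))"
  have "G \<noteq> bot"
  proof
    assume "G = bot"
    then obtain P Q where PQ: "eventually P F" "eventually Q (nhds l)" "\<And>a. P a \<Longrightarrow> Q (b a) \<Longrightarrow> False"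
      unfolding G_def trivial_limit_def eventually_inf eventually_filtercomap by metis
    then have "eventually (\<lambda>y. \<exists>a. P a \<and> y = b a) (filtermap b F)"
      by (auto simp: eventually_filtermap elim: eventually_mono)
    then have "eventually (\<lambda>_. False) (inf (nhds l) (filtermap b F))"
      unfolding eventually_inf using PQ by blast
    then show False
      using l trivial_limit_def by blast
  qed
  moreover have "((\<lambda>a. b a i) \<longlongrightarrow> l i) G" for i
  proof -
    have "(b \<longlongrightarrow> l) G"
      unfolding filterlim_def by (simp add: G_def filtermap_le_iff_le_filtercomap)
    then show ?thesis
      using continuous_on_tendsto_compose[OF continuous_on_product_coordinates[of i]] by auto
  qed
  ultimately show ?thesis
    using that[of G l] by (simp add: G_def)
qed

definition wot_tendsto :: "('a \<Rightarrow> ('h::chilbert_space \<Rightarrow>\<^sub>L 'h)) \<Rightarrow> ('h \<Rightarrow>\<^sub>L 'h) \<Rightarrow> 'a filter \<Rightarrow> bool" where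
  "wot_tendsto x l G \<longleftrightarrow> (\<forall>\<xi> \<eta>. ((\<lambda>a. cinner \<xi> (x a \<eta>)) \<longlongrightarrow> cinner \<xi> (l \<eta>)) G)"

lemma wot_tendstoD: "wot_tendsto x l G \<Longrightarrow> ((\<lambda>a. cinner \<xi> (x a \<eta>)) \<longlongrightarrow> cinner \<xi> (l \<eta>)) G"
  by (simp add: wot_tendsto_def)

lemma wot_limit_unique:
  assumes "wot_tendsto x l G" "wot_tendsto x l' G" "G \<noteq> bot"
  shows "l = l'"
  using assms by (intro op_eqI) (meson tendsto_unique wot_tendstoD)

lemma wot_tendsto_const: "wot_tendsto (\<lambda>_. l) l G"
  by (simp add: wot_tendsto_def)

lemma wot_tendsto_add:
  "wot_tendsto x l G \<Longrightarrow> wot_tendsto y k G \<Longrightarrow> wot_tendsto (\<lambda>a. x a + y a) (l + k) G"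
  unfolding wot_tendsto_def blinfun.add_left cinner.add_right by (auto intro: tendsto_add)

lemma wot_tendsto_diff:
  "wot_tendsto x l G \<Longrightarrow> wot_tendsto y k G \<Longrightarrow> wot_tendsto (\<lambda>a. x a - y a) (l - k) G"
  unfolding wot_tendsto_def blinfun.diff_left cinner.diff_right by (auto intro: tendsto_diff)

lemma wot_tendsto_op_scale:
  "wot_tendsto x l G \<Longrightarrow> wot_tendsto (\<lambda>a. op_scale c (x a)) (op_scale c l) G"
  unfolding wot_tendsto_def op_scale_apply cinner_scaleC_right by (auto intro: tendsto_mult_left)

lemma wot_tendsto_compose:
  assumes "wot_tendsto x l G" "u \<in> bounded_ops"
  shows "wot_tendsto (\<lambda>a. u o\<^sub>L x a o\<^sub>L v) (u o\<^sub>L l o\<^sub>L v) G"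
  using assms unfolding wot_tendsto_def by (simp add: op_adjoint(1)[OF assms(2), symmetric])

lemma wot_tendsto_cong:
  assumes ev: "\<forall>\<^sub>F a in G. x a = y a" and x: "wot_tendsto x l G"
  shows "wot_tendsto y l G"
  unfolding wot_tendsto_def
proof (intro allI)
  fix \<xi> \<eta>
  have "\<forall>\<^sub>F a in G. cinner \<xi> (x a \<eta>) = cinner \<xi> (y a \<eta>)"
    using ev by eventually_elim simp
  with wot_tendstoD[OF x] show "((\<lambda>a. cinner \<xi> (y a \<eta>)) \<longlongrightarrow> cinner \<xi> (l \<eta>)) G"
    by (rule Lim_transform_eventually)
qed

text \<open>Bounded nets of operators have weakly convergent subnets: along a filter making all matrix
  coefficients converge, the limits form a bounded sesquilinear form.\<close>

lemma bounded_ops_wot_convergent_subfilter: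
  fixes x :: "'a \<Rightarrow> 'i \<Rightarrow> ('h::chilbert_space \<Rightarrow>\<^sub>L 'h)"
  assumes F: "F \<noteq> bot"
    and bound: "\<forall>\<^sub>F a in F. \<forall>i. x a i \<in> bounded_ops \<and> norm (x a i) \<le> C i"
  obtains G l where "G \<le> F" "G \<noteq> bot"
    "\<And>i. wot_tendsto (\<lambda>a. x a i) (l i) G" "\<And>i. l i \<in> bounded_ops" "\<And>i. norm (l i) \<le> C i"
proof -
  define b where "b a j = cinner (fst (snd j)) (x a (fst j) (snd (snd j)))" for a and j :: "'i \<times> 'h \<times> 'h"
  have "\<forall>\<^sub>F a in F. \<forall>j. cmod (b a j) \<le> C (fst j) * norm (fst (snd j)) * norm (snd (snd j))"
    using bound
  proof eventually_elim
    case (elim a)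
    show ?case
    proof
      fix j
      have "cmod (b a j) \<le> norm (x a (fst j)) * norm (fst (snd j)) * norm (snd (snd j))"
        unfolding b_def by (rule cmod_cinner_op_le)
      also have "\<dots> \<le> C (fst j) * norm (fst (snd j)) * norm (snd (snd j))"
        using elim by (intro mult_right_mono) auto
      finally show "cmod (b a j) \<le> C (fst j) * norm (fst (snd j)) * norm (snd (snd j))" .
    qed
  qed
  from bounded_family_convergent_subfilter[OF F this]
  obtain G B where G: "G \<le> F" "G \<noteq> bot" and B: "\<And>j. ((\<lambda>a. b a j) \<longlongrightarrow> B j) G"
    by metis
  have lim: "((\<lambda>a. cinner \<xi> (x a i \<eta>)) \<longlongrightarrow> B (i, \<xi>, \<eta>)) G" for i \<xi> \<eta>
    using B[of "(i, \<xi>, \<eta>)"] by (simp add: b_def)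
  have ev: "\<forall>\<^sub>F a in G. \<forall>i. x a i \<in> bounded_ops \<and> norm (x a i) \<le> C i"
    using G(1) bound by (rule filter_leD)
  have C: "0 \<le> C i" for i
  proof -
    have "\<forall>\<^sub>F a in G. 0 \<le> C i"
      using ev by eventually_elim (meson norm_ge_zero order_trans)
    then show ?thesis
      using G(2) by simp
  qed
  have "\<exists>T. T \<in> bounded_ops \<and> (\<forall>\<xi> \<eta>. cinner \<xi> (blinfun_apply T \<eta>) = B (i, \<xi>, \<eta>)) \<and> norm T \<le> C i" for i
  proof (rule bounded_operator_of_form[where B = "\<lambda>\<xi> \<eta>. B (i, \<xi>, \<eta>)" and C = "C i"])
    show "B (i, \<xi> + \<xi>', \<eta>) = B (i, \<xi>, \<eta>) + B (i, \<xi>', \<eta>)" for \<xi> \<xi>' \<eta>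
      using tendsto_add[OF lim[of \<xi> i \<eta>] lim[of \<xi>' i \<eta>]] lim[of "\<xi> + \<xi>'" i \<eta>]
      by (simp add: cinner.add_left tendsto_unique[OF G(2)])
    show "B (i, \<xi>, \<eta> + \<eta>') = B (i, \<xi>, \<eta>) + B (i, \<xi>, \<eta>')" for \<xi> \<eta> \<eta>'
      using tendsto_add[OF lim[of \<xi> i \<eta>] lim[of \<xi> i \<eta>']] lim[of \<xi> i "\<eta> + \<eta>'"]
      by (simp add: cinner.add_right blinfun.add_right tendsto_unique[OF G(2)])
    show "B (i, scaleC c \<xi>, \<eta>) = cnj c * B (i, \<xi>, \<eta>)" for c \<xi> \<eta>
      using tendsto_mult_left[OF lim[of \<xi> i \<eta>], of "cnj c"] lim[of "scaleC c \<xi>" i \<eta>]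
      by (simp add: cinner_scaleC_left tendsto_unique[OF G(2)])
    show "B (i, \<xi>, scaleC c \<eta>) = c * B (i, \<xi>, \<eta>)" for c \<xi> \<eta>
    proof -
      have "\<forall>\<^sub>F a in G. cinner \<xi> (x a i (scaleC c \<eta>)) = c * cinner \<xi> (x a i \<eta>)"
        using ev by eventually_elim (simp add: bounded_op_scaleC cinner_scaleC_right)
      then have "((\<lambda>a. c * cinner \<xi> (x a i \<eta>)) \<longlongrightarrow> B (i, \<xi>, scaleC c \<eta>)) G"
        using lim[of \<xi> i "scaleC c \<eta>"] by (rule Lim_transform_eventually[rotated])
      then show ?thesis
        using tendsto_mult_left[OF lim[of \<xi> i \<eta>], of c] tendsto_unique[OF G(2)] by blast
    qed
    show "cmod (B (i, \<xi>, \<eta>)) \<le> C i * norm \<xi> * norm \<eta>" for \<xi> \<eta>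
    proof (rule tendsto_upperbound[OF tendsto_norm[OF lim] _ G(2)])
      show "\<forall>\<^sub>F a in G. cmod (cinner \<xi> (x a i \<eta>)) \<le> C i * norm \<xi> * norm \<eta>"
        using ev
      proof eventually_elim
        case (elim a)
        then have "norm (x a i) * norm \<xi> * norm \<eta> \<le> C i * norm \<xi> * norm \<eta>"
          by (intro mult_right_mono) auto
        then show ?case
          using cmod_cinner_op_le order_trans by blast
      qed
    qed
  qed (use C in auto)
  then obtain l where l: "\<And>i. l i \<in> bounded_ops"
      "\<And>i \<xi> \<eta>. cinner \<xi> (blinfun_apply (l i) \<eta>) = B (i, \<xi>, \<eta>)" "\<And>i. norm (l i) \<le> C i"
    by metis
  show ?thesis
    by (rule that[OF G, of l]) (use l lim in \<open>auto simp: wot_tendsto_def\<close>)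
qed

text \<open>On bounded sets weak operator convergence is ultraweak convergence, by dominated convergence
  of the defining series.\<close>

lemma ultraweakly_continuous_wot_tendsto:
  fixes \<omega> :: "('h::chilbert_space \<Rightarrow>\<^sub>L 'h) \<Rightarrow> complex"
  assumes \<omega>: "continuous_map (ultraweak_topology N) euclidean \<omega>"
    and x: "wot_tendsto x l G" and ev: "\<forall>\<^sub>F a in G. x a \<in> N \<and> norm (x a) \<le> C"
    and l: "l \<in> N" and G: "G \<noteq> bot"
  shows "((\<lambda>a. \<omega> (x a)) \<longlongrightarrow> \<omega> l) G"
proof -
  have "((\<lambda>a. \<Sum>n. cinner (\<xi> n) (x a (\<eta> n))) \<longlongrightarrow> (\<Sum>n. cinner (\<xi> n) (l (\<eta> n)))) G"
    if \<xi>: "summable (\<lambda>n::nat. (norm (\<xi> n))\<^sup>2)" and \<eta>: "summable (\<lambda>n::nat. (norm (\<eta> n))\<^sup>2)" for \<xi> \<eta>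
  proof -
    define B where "B n = C * ((norm (\<xi> n))\<^sup>2 + (norm (\<eta> n))\<^sup>2)" for n
    have "\<forall>\<^sub>F a in G. \<forall>n. cmod (cinner (\<xi> n) (x a (\<eta> n))) \<le> B n"
      using ev
    proof eventually_elim
      case (elim a)
      show ?case
      proof
        fix n
        have "0 \<le> C"
          using elim norm_ge_zero order_trans by blast
        have "norm (\<xi> n) * norm (\<eta> n) \<le> (norm (\<xi> n))\<^sup>2 + (norm (\<eta> n))\<^sup>2"
          using sum_squares_bound[of "norm (\<xi> n)" "norm (\<eta> n)"]
            mult_nonneg_nonneg[OF norm_ge_zero[of "\<xi> n"] norm_ge_zero[of "\<eta> n"]] by linarith
        then have "C * (norm (\<xi> n) * norm (\<eta> n)) \<le> B n"
          unfolding B_def using \<open>0 \<le> C\<close> by (rule mult_left_mono)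
        moreover have "norm (x a) * (norm (\<xi> n) * norm (\<eta> n)) \<le> C * (norm (\<xi> n) * norm (\<eta> n))"
          using elim by (intro mult_right_mono) auto
        ultimately show "cmod (cinner (\<xi> n) (x a (\<eta> n))) \<le> B n"
          using cmod_cinner_op_le[of "\<xi> n" "x a" "\<eta> n"] by (simp add: mult.assoc)
      qed
    qed
    then have "eventually (\<lambda>(n, a). cmod (cinner (\<xi> n) (x a (\<eta> n))) \<le> B n) (at_top \<times>\<^sub>F G)"
      unfolding eventually_prod_filter by (intro exI[of _ "\<lambda>_. True"] exI conjI) auto
    moreover have "summable B"
      unfolding B_def by (intro summable_mult summable_add \<xi> \<eta>)
    ultimately show ?thesis
      using tannerys_theorem[where a = "\<lambda>n a. cinner (\<xi> n) (x a (\<eta> n))", OF wot_tendstoD[OF x] _ _ G]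
      by blast
  qed
  then have "limitin (ultraweak_topology N) x l G"
    unfolding ultraweak_topology_def
    by (intro limitin_initial_topology l) (use ev in \<open>auto elim: eventually_mono\<close>)
  from continuous_map_limit[OF \<omega> this] show ?thesis
    by (simp add: o_def)
qed

context von_neumann
begin

text \<open>Commutation with an operator \<open>A\<close> of the commutant is expressed by matrix coefficients, after
  moving \<open>A\<close> to the other side as \<open>A\<^sup>*\<close>.\<close>

lemma wot_limit_mem:
  assumes x: "wot_tendsto x l G" and ev: "\<forall>\<^sub>F a in G. x a \<in> N" and G: "G \<noteq> bot"
    and l: "l \<in> bounded_ops"
  shows "l \<in> N"
  unfolding mem_iff_commutes
proof (intro conjI ballI allI l cinner_ext_right)
  fix A \<eta> \<xi>
  assume A: "A \<in> commutant N"
  note A' = commutant_bounded_op[OF A]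
  have "\<forall>\<^sub>F a in G. cinner \<xi> (x a (A \<eta>)) = cinner (op_adjoint A \<xi>) (x a \<eta>)"
    using ev by eventually_elim (use A A' in \<open>simp add: mem_iff_commutes op_adjoint(1)\<close>)
  moreover have "((\<lambda>a. cinner \<xi> (x a (A \<eta>))) \<longlongrightarrow> cinner \<xi> (l (A \<eta>))) G"
    by (rule wot_tendstoD[OF x])
  ultimately have "((\<lambda>a. cinner (op_adjoint A \<xi>) (x a \<eta>)) \<longlongrightarrow> cinner \<xi> (l (A \<eta>))) G"
    by (rule Lim_transform_eventually[rotated])
  then have "cinner \<xi> (l (A \<eta>)) = cinner (op_adjoint A \<xi>) (l \<eta>)"
    using wot_tendstoD[OF x] tendsto_unique[OF G] by blast
  then show "cinner \<xi> (l (A \<eta>)) = cinner \<xi> (A (l \<eta>))"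
    by (simp add: op_adjoint(1)[OF A'])
qed

lemma bounded_wot_convergent_subfilter:
  assumes F: "F \<noteq> bot" and bound: "\<forall>\<^sub>F a in F. x a \<in> N \<and> norm (x a) \<le> C"
  obtains G l where "G \<le> F" "G \<noteq> bot" "wot_tendsto x l G" "l \<in> N" "norm l \<le> C"
proof -
  have "\<forall>\<^sub>F a in F. \<forall>i::unit. x a \<in> bounded_ops \<and> norm (x a) \<le> C"
    using bound by eventually_elim (simp add: bounded_op)
  from bounded_ops_wot_convergent_subfilter[OF F this]
  obtain G and l :: "unit \<Rightarrow> _" where G: "G \<le> F" "G \<noteq> bot"
    and l: "\<And>i. wot_tendsto x (l i) G" "\<And>i. l i \<in> bounded_ops" "\<And>i. norm (l i) \<le> C"
    by metis
  have "\<forall>\<^sub>F a in G. x a \<in> N"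
    using G(1) by (rule filter_leD) (use bound in \<open>auto elim: eventually_mono\<close>)
  then show ?thesis
    using that[OF G l(1)] wot_limit_mem[OF l(1) _ G(2) l(2)] l(3) by blast
qed

text \<open>Otherwise there would be operators \<open>x n\<close> of norm at most 1 with \<open>\<bar>\<omega> (x n)\<bar> > n\<close>, contradicting
  the convergence of \<open>\<omega> (x n)\<close> along a subnet.\<close>

lemma normal_functional_bounded:
  assumes lin: "linear_functional_on N \<omega>"
    and \<omega>: "continuous_map (ultraweak_topology N) euclidean \<omega>"
  shows "\<exists>K. \<forall>x\<in>N. norm x \<le> 1 \<longrightarrow> cmod (\<omega> x) \<le> K"
proof (rule ccontr)
  assume "\<not> ?thesis"
  then have "\<forall>n::nat. \<exists>x\<in>N. norm x \<le> 1 \<and> real n < cmod (\<omega> x)"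
    by (meson not_le)
  then obtain x where x: "\<And>n. x n \<in> N \<and> norm (x n) \<le> 1" "\<And>n. real n < cmod (\<omega> (x n))"
    by metis
  obtain G l where G: "G \<le> sequentially" "G \<noteq> bot" and l: "wot_tendsto x l G" "l \<in> N"
    by (rule bounded_wot_convergent_subfilter[of sequentially x 1]) (use x(1) in auto)
  have "((\<lambda>n. \<omega> (x n)) \<longlongrightarrow> \<omega> l) G"
    using x(1) by (intro ultraweakly_continuous_wot_tendsto[OF \<omega> l(1) _ l(2) G(2), of 1]) simp
  then have "((\<lambda>n. cmod (\<omega> (x n))) \<longlongrightarrow> cmod (\<omega> l)) G"
    by (rule tendsto_norm)
  then have "\<forall>\<^sub>F n in G. cmod (\<omega> (x n)) < cmod (\<omega> l) + 1"
    by (rule order_tendstoD) simp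
  moreover have "\<forall>\<^sub>F n in G. cmod (\<omega> l) + 1 \<le> real n"
    using filterlim_real_sequentially unfolding filterlim_at_top by (blast intro: filter_leD[OF G(1)])
  ultimately have "\<forall>\<^sub>F n in G. False"
  proof eventually_elim
    case (elim n)
    then show ?case
      using x(2)[of n] by linarith
  qed
  then show False
    using G(2) by simp
qed

end

section \<open>The GNS norm of a faithful normal state\<close>

locale normal_state = von_neumann N for N :: "('h::chilbert_space \<Rightarrow>\<^sub>L 'h) set" +
  fixes \<psi> :: "('h \<Rightarrow>\<^sub>L 'h) \<Rightarrow> complex"
  assumes faithful_normal_state: "faithful_normal_state N \<psi>"
begin

abbreviation gnorm :: "('h \<Rightarrow>\<^sub>L 'h) \<Rightarrow> real" where
  "gnorm \<equiv> gns_norm \<psi>"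

lemma
  shows state_linear: "linear_functional_on N \<psi>"
    and state_nonneg: "x \<in> N \<Longrightarrow> positive_op x \<Longrightarrow> \<psi> x \<in> \<real>\<^sub>\<ge>\<^sub>0"
    and state_normal: "continuous_map (ultraweak_topology N) euclidean \<psi>"
    and state_faithful: "x \<in> N \<Longrightarrow> positive_op x \<Longrightarrow> \<psi> x = 0 \<Longrightarrow> x = 0"
  using faithful_normal_state by (auto simp: faithful_normal_state_def)

lemma state_add: "x \<in> N \<Longrightarrow> y \<in> N \<Longrightarrow> \<psi> (x + y) = \<psi> x + \<psi> y"
  and state_op_scale: "x \<in> N \<Longrightarrow> \<psi> (op_scale c x) = c * \<psi> x"
  using state_linear by (auto simp: linear_functional_on_def)

lemma state_scaleR: "x \<in> N \<Longrightarrow> \<psi> (r *\<^sub>R x) = of_real r * \<psi> x"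
  using state_op_scale[of x "of_real r"] by (simp add: op_scale_of_real)

lemma state_diff: "x \<in> N \<Longrightarrow> y \<in> N \<Longrightarrow> \<psi> (x - y) = \<psi> x - \<psi> y"
  using state_add[of "x - y" y] diff_mem[of x y] by simp

lemma state_mono:
  assumes "x \<in> N" "y \<in> N" "positive_op (y - x)"
  shows "Re (\<psi> x) \<le> Re (\<psi> y)"
  using state_nonneg[OF diff_mem[OF assms(2,1)] assms(3)]
  by (simp add: state_diff assms complex_nonneg_Reals_iff)

lemma state_square: "x \<in> N \<Longrightarrow> \<psi> (op_adjoint x o\<^sub>L x) = of_real ((gnorm x)\<^sup>2)"
  and gnorm_nonneg: "x \<in> N \<Longrightarrow> 0 \<le> gnorm x"
  using state_nonneg[OF compose_mem[OF adjoint_mem] positive_adjoint_compose[OF bounded_op]]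
  by (auto simp: gns_norm_def complex_eq_iff complex_nonneg_Reals_iff)

lemma state_square_add:
  assumes "x \<in> N" "y \<in> N"
  shows "\<psi> (op_adjoint (x + op_scale c y) o\<^sub>L (x + op_scale c y)) =
    \<psi> (op_adjoint x o\<^sub>L x) + c * \<psi> (op_adjoint x o\<^sub>L y) + cnj c * \<psi> (op_adjoint y o\<^sub>L x)
      + c * cnj c * \<psi> (op_adjoint y o\<^sub>L y)"
proof -
  have "op_adjoint (x + op_scale c y) o\<^sub>L (x + op_scale c y) =
    (op_adjoint x o\<^sub>L x) + op_scale c (op_adjoint x o\<^sub>L y) + op_scale (cnj c) (op_adjoint y o\<^sub>L x)
      + op_scale (c * cnj c) (op_adjoint y o\<^sub>L y)"
  proof (rule op_eqI)
    fix \<xi> \<eta>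
    have "x + op_scale c y \<in> bounded_ops"
      by (intro bounded_op add_mem op_scale_mem assms)
    then show "cinner \<xi> ((op_adjoint (x + op_scale c y) o\<^sub>L (x + op_scale c y)) \<eta>) =
        cinner \<xi> (((op_adjoint x o\<^sub>L x) + op_scale c (op_adjoint x o\<^sub>L y)
          + op_scale (cnj c) (op_adjoint y o\<^sub>L x) + op_scale (c * cnj c) (op_adjoint y o\<^sub>L y)) \<eta>)"
      by (simp add: op_adjoint_right bounded_op assms blinfun.add_left cinner.add_left cinner.add_right
          cinner_scaleC_left cinner_scaleC_right algebra_simps)
  qed
  then show ?thesis
    by (simp add: state_add state_op_scale assms add_mem op_scale_mem compose_mem adjoint_mem)
qed

lemma state_Cauchy_Schwarz:
  assumes "x \<in> N" "y \<in> N"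
  shows "cmod (\<psi> (op_adjoint x o\<^sub>L y)) \<le> gnorm x * gnorm y"
    and "\<psi> (op_adjoint y o\<^sub>L x) = cnj (\<psi> (op_adjoint x o\<^sub>L y))"
proof -
  have *: "\<psi> (op_adjoint x o\<^sub>L x) + c * \<psi> (op_adjoint x o\<^sub>L y) + cnj c * \<psi> (op_adjoint y o\<^sub>L x)
      + c * cnj c * \<psi> (op_adjoint y o\<^sub>L y) \<in> \<real>\<^sub>\<ge>\<^sub>0" for c
    using state_square[OF add_mem[OF assms(1) op_scale_mem[OF assms(2), of c]]]
    unfolding state_square_add[OF assms] by (simp del: of_real_power)
  have **: "\<psi> (op_adjoint y o\<^sub>L y) \<in> \<real>\<^sub>\<ge>\<^sub>0"
    by (simp add: state_square assms del: of_real_power)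
  show "\<psi> (op_adjoint y o\<^sub>L x) = cnj (\<psi> (op_adjoint x o\<^sub>L y))"
    by (rule nonneg_quadratic_form(1)[OF * **])
  have "(cmod (\<psi> (op_adjoint x o\<^sub>L y)))\<^sup>2 \<le> (gnorm x * gnorm y)\<^sup>2"
    using nonneg_quadratic_form(2)[OF * **] by (simp add: state_square assms power_mult_distrib)
  then show "cmod (\<psi> (op_adjoint x o\<^sub>L y)) \<le> gnorm x * gnorm y"
    by (rule power2_le_imp_le) (simp add: gnorm_nonneg assms)
qed

lemma gnorm_triangle:
  assumes "x \<in> N" "y \<in> N"
  shows "gnorm (x + y) \<le> gnorm x + gnorm y"
proof (rule power2_le_imp_le)
  have "complex_of_real ((gnorm (x + y))\<^sup>2) = of_real ((gnorm x)\<^sup>2) + \<psi> (op_adjoint x o\<^sub>L y)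
      + cnj (\<psi> (op_adjoint x o\<^sub>L y)) + of_real ((gnorm y)\<^sup>2)"
    using state_square_add[OF assms, of 1] op_scale_of_real[of 1 y]
    by (simp add: state_square assms add_mem state_Cauchy_Schwarz(2)[OF assms] del: of_real_power)
  then have "(gnorm (x + y))\<^sup>2 = (gnorm x)\<^sup>2 + 2 * Re (\<psi> (op_adjoint x o\<^sub>L y)) + (gnorm y)\<^sup>2"
    by (simp add: complex_eq_iff del: of_real_power)
  also have "Re (\<psi> (op_adjoint x o\<^sub>L y)) \<le> gnorm x * gnorm y"
    using complex_Re_le_cmod state_Cauchy_Schwarz(1)[OF assms] order_trans by blast
  finally show "(gnorm (x + y))\<^sup>2 \<le> (gnorm x + gnorm y)\<^sup>2"
    by (simp add: power2_sum)
qed (simp add: gnorm_nonneg assms)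

lemma gnorm_zero [simp]: "gnorm 0 = 0"
  using state_scaleR[of 0 0] zero_mem by (simp add: gns_norm_def)

lemma gnorm_diff_commute:
  assumes "x \<in> N" "y \<in> N"
  shows "gnorm (x - y) = gnorm (y - x)"
proof -
  have "op_adjoint (x - y) o\<^sub>L (x - y) = op_adjoint (y - x) o\<^sub>L (y - x)"
    by (rule op_eqI) (simp add: op_adjoint_diff assms blinfun.diff_left blinfun.diff_right cinner.diff_right)
  then show ?thesis
    by (simp add: gns_norm_def)
qed

lemma gnorm_diff_triangle:
  assumes "x \<in> N" "y \<in> N" "z \<in> N"
  shows "gnorm (x - z) \<le> gnorm (x - y) + gnorm (y - z)"
  using gnorm_triangle[OF diff_mem[OF assms(1,2)] diff_mem[OF assms(2,3)]] by simp

lemma gnorm_eq_0: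
  assumes "x \<in> N" "gnorm x = 0"
  shows "x = 0"
proof -
  have "op_adjoint x o\<^sub>L x = 0"
    using assms by (intro state_faithful positive_adjoint_compose compose_mem adjoint_mem bounded_op)
      (simp_all add: state_square)
  then have "cinner (x \<xi>) (x \<xi>) = 0" for \<xi>
    using op_adjoint_right[OF bounded_op[OF assms(1)], of \<xi> "x \<xi>"]
    by (metis blinfun_apply_blinfun_compose cinner.zero_right zero_blinfun.rep_eq)
  then show ?thesis
    by (intro blinfun_eqI) (simp add: cinner_self)
qed

text \<open>Immediate from \<open>x\<^sup>* a\<^sup>* a x \<le> \<parallel>a\<parallel>\<^sup>2 x\<^sup>* x\<close>. Right multiplication has no such bound, since \<open>\<psi>\<close> need
  not be a trace.\<close>

lemma gnorm_left_mult:
  assumes a: "a \<in> N" and x: "x \<in> N"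
  shows "gnorm (a o\<^sub>L x) \<le> norm a * gnorm x"
proof (rule power2_le_imp_le)
  let ?X = "op_adjoint x o\<^sub>L x" and ?A = "op_adjoint (a o\<^sub>L x) o\<^sub>L (a o\<^sub>L x)"
  have ax: "a o\<^sub>L x \<in> N"
    using a x by (rule compose_mem)
  have "positive_op ((norm a)\<^sup>2 *\<^sub>R ?X - ?A)"
    unfolding positive_op_def
  proof
    fix \<xi>
    have "cinner \<xi> (((norm a)\<^sup>2 *\<^sub>R ?X - ?A) \<xi>)
        = of_real ((norm a * norm (x \<xi>))\<^sup>2 - (norm (a (x \<xi>)))\<^sup>2)"
      using op_adjoint_right[OF bounded_op[OF x]] op_adjoint_right[OF bounded_op[OF ax]]
      by (simp add: blinfun.diff_left blinfun.scaleR_left cinner.diff_right cinner.scaleR_right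
          cinner_self power_mult_distrib scaleR_conv_of_real)
    moreover have "(norm (a (x \<xi>)))\<^sup>2 \<le> (norm a * norm (x \<xi>))\<^sup>2"
      by (intro power_mono norm_blinfun) simp
    ultimately show "cinner \<xi> (((norm a)\<^sup>2 *\<^sub>R ?X - ?A) \<xi>) \<in> \<real>\<^sub>\<ge>\<^sub>0"
      by (simp only: nonneg_Reals_of_real_iff diff_ge_0_iff_ge)
  qed
  then have "Re (\<psi> ?A) \<le> Re (\<psi> ((norm a)\<^sup>2 *\<^sub>R ?X))"
    using a x by (intro state_mono scaleR_mem compose_mem adjoint_mem)
  then show "(gnorm (a o\<^sub>L x))\<^sup>2 \<le> (norm a * gnorm x)\<^sup>2"
    using a x by (simp add: state_scaleR state_square compose_mem adjoint_mem power_mult_distrib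
        del: of_real_power)
qed (simp add: gnorm_nonneg x)

text \<open>Two-sided multiplication preserves bounded weak limits, so that \<open>\<psi> (u \<cdot> v)\<close> respects them
  because \<open>\<psi>\<close> does.\<close>

lemma state_wot_tendsto:
  assumes x: "wot_tendsto x l G" and ev: "\<forall>\<^sub>F a in G. x a \<in> N \<and> norm (x a) \<le> C"
    and l: "l \<in> N" and G: "G \<noteq> bot" and u: "u \<in> N" and v: "v \<in> N"
  shows "((\<lambda>a. \<psi> (u o\<^sub>L x a o\<^sub>L v)) \<longlongrightarrow> \<psi> (u o\<^sub>L l o\<^sub>L v)) G"
proof (rule ultraweakly_continuous_wot_tendsto[OF state_normal _ _ _ G])
  show "wot_tendsto (\<lambda>a. u o\<^sub>L x a o\<^sub>L v) (u o\<^sub>L l o\<^sub>L v) G"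
    using x bounded_op[OF u] by (rule wot_tendsto_compose)
  show "\<forall>\<^sub>F a in G. u o\<^sub>L x a o\<^sub>L v \<in> N \<and> norm (u o\<^sub>L x a o\<^sub>L v) \<le> norm u * C * norm v"
    using ev
  proof eventually_elim
    case (elim a)
    have "norm (u o\<^sub>L x a o\<^sub>L v) \<le> norm (u o\<^sub>L x a) * norm v"
      by (rule norm_blinfun_compose)
    also have "\<dots> \<le> norm u * norm (x a) * norm v"
      by (intro mult_right_mono norm_blinfun_compose) simp
    also have "\<dots> \<le> norm u * C * norm v"
      using elim by (intro mult_right_mono mult_left_mono) auto
    finally show ?case
      using elim u v by (simp add: compose_mem)
  qed
  show "u o\<^sub>L l o\<^sub>L v \<in> N"
    using u l v by (intro compose_mem)
qed

text \<open>The GNS norm is a supremum of the moduli of the ultraweakly continuous functionals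
  \<open>\<psi> (u\<^sup>* \<cdot>)\<close>, \<open>\<parallel>u\<parallel>\<^sub>\<psi> \<le> 1\<close>, so that it is lower semicontinuous. Testing with \<open>u = l\<close> suffices.\<close>

lemma gnorm_wot_lower_semicontinuous:
  assumes x: "wot_tendsto x l G" and ev: "\<forall>\<^sub>F a in G. x a \<in> N \<and> norm (x a) \<le> C"
    and l: "l \<in> N" and G: "G \<noteq> bot" and le: "\<forall>\<^sub>F a in G. gnorm (x a) \<le> c"
  shows "gnorm l \<le> c"
proof -
  have "((\<lambda>a. \<psi> (op_adjoint l o\<^sub>L x a)) \<longlongrightarrow> \<psi> (op_adjoint l o\<^sub>L l)) G"
    using state_wot_tendsto[OF x ev l G adjoint_mem[OF l] id_mem] by simp
  then have "((\<lambda>a. cmod (\<psi> (op_adjoint l o\<^sub>L x a))) \<longlongrightarrow> (gnorm l)\<^sup>2) G"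
    by (auto dest: tendsto_norm simp: state_square l norm_power)
  moreover have "\<forall>\<^sub>F a in G. cmod (\<psi> (op_adjoint l o\<^sub>L x a)) \<le> gnorm l * c"
    using ev le
  proof eventually_elim
    case (elim a)
    then have "gnorm l * gnorm (x a) \<le> gnorm l * c"
      using gnorm_nonneg[OF l] by (intro mult_left_mono)
    then show ?case
      using elim state_Cauchy_Schwarz(1)[of l "x a"] l by auto
  qed
  ultimately have "(gnorm l)\<^sup>2 \<le> gnorm l * c"
    by (rule tendsto_upperbound[OF _ _ G])
  moreover have "0 \<le> c"
  proof -
    have "\<forall>\<^sub>F a in G. 0 \<le> c"
      using ev le by eventually_elim (meson gnorm_nonneg order_trans)
    then show ?thesis
      using G by simp
  qed
  ultimately show ?thesis
    using gnorm_nonneg[OF l] by (cases "gnorm l = 0") (simp_all add: power2_eq_square)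
qed

text \<open>On bounded sets, right multiplication is continuous for the GNS norm although it need not be
  bounded. If it failed, there would be bounded \<open>x n\<close> with \<open>\<psi> (x n\<^sup>* x n) \<rightarrow> 0\<close>, while
  \<open>\<psi> (y\<^sup>* x n\<^sup>* x n y)\<close> stays away from 0. A weak limit \<open>b\<close> of the positive operators \<open>x n\<^sup>* x n\<close> is
  positive with \<open>\<psi> b = 0\<close>, so that \<open>b = 0\<close> by faithfulness, and \<open>\<psi> (y\<^sup>* b y) = 0\<close> is a contradiction.\<close>

lemma right_mult_continuous_on_bounded:
  assumes y: "y \<in> N" and e: "0 < e"
  shows "\<exists>\<delta>>0. \<forall>x\<in>N. norm x \<le> C \<longrightarrow> gnorm x < \<delta> \<longrightarrow> gnorm (x o\<^sub>L y) < e"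
proof (rule ccontr)
  assume contra: "\<not> ?thesis"
  have "\<exists>x\<in>N. norm x \<le> C \<and> gnorm x < 1 / Suc n \<and> e \<le> gnorm (x o\<^sub>L y)" for n
  proof -
    have "0 < 1 / real (Suc n)"
      by simp
    then show ?thesis
      using contra by (meson not_le)
  qed
  then obtain x where x: "\<And>n. x n \<in> N" "\<And>n. norm (x n) \<le> C" "\<And>n. gnorm (x n) < 1 / Suc n"
      "\<And>n. e \<le> gnorm (x n o\<^sub>L y)"
    by metis
  define a where "a n = op_adjoint (x n) o\<^sub>L x n" for n
  have a: "a n \<in> N" "norm (a n) \<le> C * C" for n
  proof -
    show "a n \<in> N"
      unfolding a_def using x(1) by (intro compose_mem adjoint_mem)
    have "norm (a n) \<le> norm (op_adjoint (x n)) * norm (x n)"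
      unfolding a_def by (rule norm_blinfun_compose)
    also have "\<dots> \<le> C * C"
      using norm_op_adjoint_le[OF bounded_op[OF x(1)[of n]]] x(2)[of n] norm_ge_zero[of "x n"]
      by (intro mult_mono) linarith+
    finally show "norm (a n) \<le> C * C" .
  qed
  obtain G b where G: "G \<le> sequentially" "G \<noteq> bot" and b: "wot_tendsto a b G" "b \<in> N"
    by (rule bounded_wot_convergent_subfilter[of sequentially a "C * C"]) (use a in auto)
  have ev: "\<forall>\<^sub>F n in G. a n \<in> N \<and> norm (a n) \<le> C * C"
    using a by simp
  have "positive_op b"
    unfolding positive_op_def
  proof
    fix \<xi>
    show "cinner \<xi> (b \<xi>) \<in> \<real>\<^sub>\<ge>\<^sub>0"
    proof (rule Lim_in_closed_set[OF closed_nonneg_Reals_complex _ G(2) wot_tendstoD[OF b(1)]])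
      show "\<forall>\<^sub>F n in G. cinner \<xi> (a n \<xi>) \<in> \<real>\<^sub>\<ge>\<^sub>0"
        using positive_adjoint_compose[OF bounded_op[OF x(1)]] by (simp add: a_def positive_op_def)
    qed
  qed
  moreover have "\<psi> b = 0"
  proof (rule tendsto_unique[OF G(2)])
    show "((\<lambda>n. \<psi> (a n)) \<longlongrightarrow> \<psi> b) G"
      using state_wot_tendsto[OF b(1) ev b(2) G(2) id_mem id_mem] by simp
    have "(\<lambda>n. \<psi> (a n)) \<longlonglongrightarrow> 0"
    proof (rule Lim_null_comparison)
      show "\<forall>\<^sub>F n in sequentially. cmod (\<psi> (a n)) \<le> 1 / Suc n * (1 / Suc n)"
      proof (rule always_eventually, rule allI)
        fix n
        have "cmod (\<psi> (a n)) \<le> gnorm (x n) * gnorm (x n)"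
          unfolding a_def by (rule state_Cauchy_Schwarz(1)) (rule x)+
        also have "\<dots> \<le> 1 / Suc n * (1 / Suc n)"
          using x(1) x(3)[of n] by (intro mult_mono) (auto simp: gnorm_nonneg)
        finally show "cmod (\<psi> (a n)) \<le> 1 / Suc n * (1 / Suc n)" .
      qed
      show "(\<lambda>n. 1 / real (Suc n) * (1 / real (Suc n))) \<longlonglongrightarrow> 0"
        using tendsto_mult[OF LIMSEQ_Suc[OF lim_1_over_n] LIMSEQ_Suc[OF lim_1_over_n]] by simp
    qed
    then show "((\<lambda>n. \<psi> (a n)) \<longlongrightarrow> 0) G"
      by (rule tendsto_mono[OF G(1)])
  qed
  ultimately have "b = 0"
    using b(2) by (intro state_faithful)
  then have "((\<lambda>n. \<psi> (op_adjoint y o\<^sub>L a n o\<^sub>L y)) \<longlongrightarrow> 0) G"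
    using state_wot_tendsto[OF b(1) ev b(2) G(2) adjoint_mem[OF y] y] state_scaleR[of 0 0] zero_mem
    by simp
  moreover have "op_adjoint y o\<^sub>L a n o\<^sub>L y = op_adjoint (x n o\<^sub>L y) o\<^sub>L (x n o\<^sub>L y)" for n
    using x(1) y by (intro blinfun_eqI) (simp add: a_def op_adjoint_compose bounded_op compose_mem)
  ultimately have "((\<lambda>n. complex_of_real ((gnorm (x n o\<^sub>L y))\<^sup>2)) \<longlongrightarrow> 0) G"
    using x(1) y by (simp add: state_square compose_mem del: of_real_power)
  then have "((\<lambda>n. (gnorm (x n o\<^sub>L y))\<^sup>2) \<longlongrightarrow> 0) G"
    by (metis of_real_0 tendsto_of_real_iff)
  then have "\<forall>\<^sub>F n in G. (gnorm (x n o\<^sub>L y))\<^sup>2 < e\<^sup>2"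
    by (rule order_tendstoD) (use e in simp)
  moreover have "e\<^sup>2 \<le> (gnorm (x n o\<^sub>L y))\<^sup>2" for n
    using x(4) e by (intro power_mono) auto
  ultimately show False
    using G(2) by (simp add: not_less[symmetric])
qed

text \<open>Off \<open>N\<close> the value is 0, because the distance of a metric space is nonnegative and symmetric on
  the whole type.\<close>

definition gdist :: "('h \<Rightarrow>\<^sub>L 'h) \<Rightarrow> ('h \<Rightarrow>\<^sub>L 'h) \<Rightarrow> real" where
  "gdist x y = (if x \<in> N \<and> y \<in> N then gnorm (x - y) else 0)"

definition oball :: "real \<Rightarrow> ('h \<Rightarrow>\<^sub>L 'h) set" where
  "oball r = {x \<in> N. norm x \<le> r}"

lemma Metric_space_gdist: "Metric_space N gdist"
proof
  show "gdist x z \<le> gdist x y + gdist y z" if "x \<in> N" "y \<in> N" "z \<in> N" for x y z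
    using that gnorm_diff_triangle by (simp add: gdist_def)
qed (auto simp: gdist_def gnorm_nonneg diff_mem gnorm_diff_commute dest: gnorm_eq_0[OF diff_mem])

lemma Metric_space_oball: "Metric_space (oball r) gdist"
  using Metric_space_gdist by (rule Metric_space.subspace) (auto simp: oball_def)

text \<open>A Cauchy sequence in an operator norm ball has a weak cluster point in the ball, and by lower
  semicontinuity of the GNS norm the sequence converges to it.\<close>

lemma mcomplete_oball: "Metric_space.mcomplete (oball r) gdist"
proof -
  interpret B: Metric_space "oball r" gdist
    by (rule Metric_space_oball)
  show ?thesis
    unfolding B.mcomplete_def
  proof (intro allI impI)
    fix s
    assume s: "B.MCauchy s"
    then have mem: "s n \<in> N \<and> norm (s n) \<le> r" for n
      unfolding B.MCauchy_def by (auto simp: oball_def)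
    obtain G l where G: "G \<le> sequentially" "G \<noteq> bot" and l: "wot_tendsto s l G" "l \<in> N" "norm l \<le> r"
      by (rule bounded_wot_convergent_subfilter[of sequentially s r]) (use mem in auto)
    have "\<exists>n0. \<forall>n\<ge>n0. s n \<in> oball r \<and> gdist (s n) l < e" if e: "0 < e" for e
    proof -
      have "0 < e / 2"
        using e by simp
      then obtain n0 where n0: "\<And>m n. n0 \<le> m \<Longrightarrow> n0 \<le> n \<Longrightarrow> gdist (s m) (s n) < e / 2"
        using s unfolding B.MCauchy_def by blast
      have "gnorm (s n - l) \<le> e / 2" if n: "n0 \<le> n" for n
      proof (rule gnorm_wot_lower_semicontinuous[OF _ _ _ G(2)])
        show "wot_tendsto (\<lambda>m. s n - s m) (s n - l) G"
          by (rule wot_tendsto_diff[OF wot_tendsto_const l(1)])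
        show "\<forall>\<^sub>F m in G. s n - s m \<in> N \<and> norm (s n - s m) \<le> r + r"
          using mem by (intro always_eventually allI) (meson add_mono diff_mem norm_triangle_ineq4 order_trans)
        show "s n - l \<in> N"
          using mem l by (intro diff_mem) auto
        have "\<forall>\<^sub>F m in sequentially. gnorm (s n - s m) \<le> e / 2"
          using eventually_ge_at_top[of n0]
          by eventually_elim (use n0[OF n] mem in \<open>force simp: gdist_def\<close>)
        then show "\<forall>\<^sub>F m in G. gnorm (s n - s m) \<le> e / 2"
          by (rule filter_leD[OF G(1)])
      qed
      then show ?thesis
        using e mem l(2) by (intro exI[of _ n0]) (force simp: gdist_def oball_def)
    qed
    then show "\<exists>l. limitin B.mtopology s l sequentially"
      using l unfolding B.limit_metric_sequentially by (auto simp: oball_def intro!: exI[of _ l])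
  qed
qed

end

section \<open>Separability of balls\<close>

text \<open>For proofs of separability: it suffices that each nonempty open set includes a nonempty member of
  the countable family \<open>\<B>\<close>.\<close>

lemma countable_meeting_set:
  assumes "countable \<B>"
  shows "\<exists>A. countable A \<and> A \<subseteq> \<Union>\<B> \<and> (\<forall>B\<in>\<B>. B \<noteq> {} \<longrightarrow> A \<inter> B \<noteq> {})"
proof -
  let ?A = "(\<lambda>B. SOME x. x \<in> B) ` (\<B> - {{}})"
  have "countable ?A"
    using assms by simp
  moreover have "(SOME x. x \<in> B) \<in> B" if "B \<noteq> {}" for B :: "'a set"
    using that by (simp add: some_in_eq)
  ultimately show ?thesis
    by (intro exI[of _ ?A]) blast
qed

context von_neumann
begin

lemma functional_norm_upper:
  assumes "\<forall>x\<in>N. norm x \<le> 1 \<longrightarrow> cmod (f x) \<le> K" "x \<in> N" "norm x \<le> 1"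
  shows "cmod (f x) \<le> functional_norm N f"
  unfolding functional_norm_def
  by (rule cSUP_upper) (use assms in \<open>auto intro!: bdd_aboveI\<close>)

lemma functional_norm_least:
  assumes "\<forall>x\<in>N. norm x \<le> 1 \<longrightarrow> cmod (f x) \<le> K"
  shows "functional_norm N f \<le> K"
  unfolding functional_norm_def
  by (rule cSUP_least) (use assms zero_mem in \<open>auto intro: exI[of _ 0]\<close>)

lemma predual_diff_bounded:
  assumes "\<omega> \<in> predual N" "\<omega>' \<in> predual N"
  shows "\<exists>K. \<forall>x\<in>N. norm x \<le> 1 \<longrightarrow> cmod (\<omega> x - \<omega>' x) \<le> K"
proof -
  obtain K K' where "\<forall>x\<in>N. norm x \<le> 1 \<longrightarrow> cmod (\<omega> x) \<le> K" "\<forall>x\<in>N. norm x \<le> 1 \<longrightarrow> cmod (\<omega>' x) \<le> K'"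
    using normal_functional_bounded assms unfolding predual_def by blast
  then show ?thesis
    by (intro exI[of _ "K + K'"]) (meson add_mono norm_triangle_ineq4 order_trans)
qed

lemma predual_dist_upper:
  assumes "\<omega> \<in> predual N" "\<omega>' \<in> predual N" "x \<in> N" "norm x \<le> r"
  shows "cmod (\<omega> x - \<omega>' x) \<le> r * functional_norm N (\<lambda>x. \<omega> x - \<omega>' x)"
proof (cases "r = 0")
  case True
  have "\<omega> (op_scale 0 x) = 0 * \<omega> x" "\<omega>' (op_scale 0 x) = 0 * \<omega>' x"
    using assms by (simp_all add: predual_def linear_functional_on_def)
  moreover have "op_scale 0 x = 0"
    using op_scale_of_real[of 0 x] by simp
  ultimately show ?thesis
    using True assms(4) by simp
next
  case False
  then have r: "0 < r"
    using norm_ge_zero[of x] assms(4) by linarith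
  define y where "y = op_scale (of_real (1 / r)) x"
  have y: "y \<in> N" "norm y \<le> 1"
    using assms(3,4) r unfolding y_def by (simp_all add: scaleR_mem op_scale_of_real del: of_real_divide)
  have "\<omega> y - \<omega>' y = of_real (1 / r) * (\<omega> x - \<omega>' x)"
    using assms unfolding y_def by (simp add: predual_def linear_functional_on_def algebra_simps)
  then have "cmod (\<omega> y - \<omega>' y) = cmod (\<omega> x - \<omega>' x) / r"
    using r by (simp add: norm_mult norm_divide)
  moreover have "cmod (\<omega> y - \<omega>' y) \<le> functional_norm N (\<lambda>x. \<omega> x - \<omega>' x)"
    using predual_diff_bounded[OF assms(1,2)] y by (auto intro: functional_norm_upper)
  ultimately show ?thesis
    using r by (simp add: field_simps) (metis mult_left_mono less_imp_le)
qed

lemma Metric_space_predual: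
  "Metric_space (predual N) (\<lambda>\<omega> \<omega>'. if \<omega> \<in> predual N \<and> \<omega>' \<in> predual N
     then functional_norm N (\<lambda>x. \<omega> x - \<omega>' x) else 0)" (is "Metric_space _ ?d")
proof
  have nonneg: "0 \<le> functional_norm N (\<lambda>x. \<omega> x - \<omega>' x)"
    if "\<omega> \<in> predual N" "\<omega>' \<in> predual N" for \<omega> \<omega>'
    using predual_dist_upper[OF that id_mem, of 1] norm_ge_zero[of "\<omega> id_blinfun - \<omega>' id_blinfun"]
      norm_blinfun_id_le by (smt (verit))
  then show "0 \<le> ?d \<omega> \<omega>'" for \<omega> \<omega>'
    by simp
  show "?d \<omega> \<omega>' = ?d \<omega>' \<omega>" for \<omega> \<omega>'
    by (simp add: functional_norm_def norm_minus_commute)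
  show "?d \<omega> \<omega>' = 0 \<longleftrightarrow> \<omega> = \<omega>'" if pre: "\<omega> \<in> predual N" "\<omega>' \<in> predual N" for \<omega> \<omega>'
  proof
    assume "?d \<omega> \<omega>' = 0"
    then have "\<omega> x = \<omega>' x" if "x \<in> N" for x
      using predual_dist_upper[OF pre that, of "norm x"] pre by simp
    then show "\<omega> = \<omega>'"
      using pre by (intro extensionalityI[of _ N]) (auto simp: predual_def)
  next
    assume "\<omega> = \<omega>'"
    then show "?d \<omega> \<omega>' = 0"
      using nonneg[OF pre] functional_norm_least[of "\<lambda>x. \<omega> x - \<omega>' x" 0] pre by simp
  qed
  show "?d \<omega>1 \<omega>3 \<le> ?d \<omega>1 \<omega>2 + ?d \<omega>2 \<omega>3"
    if pre: "\<omega>1 \<in> predual N" "\<omega>2 \<in> predual N" "\<omega>3 \<in> predual N" for \<omega>1 \<omega>2 \<omega>3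
  proof -
    have "functional_norm N (\<lambda>x. \<omega>1 x - \<omega>3 x)
        \<le> functional_norm N (\<lambda>x. \<omega>1 x - \<omega>2 x) + functional_norm N (\<lambda>x. \<omega>2 x - \<omega>3 x)"
    proof (rule functional_norm_least, intro ballI impI)
      fix x
      assume x: "x \<in> N" "norm x \<le> 1"
      show "cmod (\<omega>1 x - \<omega>3 x)
        \<le> functional_norm N (\<lambda>x. \<omega>1 x - \<omega>2 x) + functional_norm N (\<lambda>x. \<omega>2 x - \<omega>3 x)"
        using predual_dist_upper[OF pre(1,2) x] predual_dist_upper[OF pre(2,3) x]
          norm_triangle_ineq[of "\<omega>1 x - \<omega>2 x" "\<omega>2 x - \<omega>3 x"] by simp
    qed
    then show ?thesis
      using pre by simp
  qed
qed

end

context normal_state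
begin

text \<open>Set to \<open>undefined\<close> off \<open>N\<close>, as for all elements of the predual.\<close>

definition state_functional :: "('h \<Rightarrow>\<^sub>L 'h) \<Rightarrow> ('h \<Rightarrow>\<^sub>L 'h) \<Rightarrow> complex" where
  "state_functional x = (\<lambda>y\<in>N. \<psi> (op_adjoint x o\<^sub>L y))"

lemma state_functional_predual:
  assumes x: "x \<in> N"
  shows "state_functional x \<in> predual N"
proof -
  have "continuous_map (ultraweak_topology N) (ultraweak_topology N) (\<lambda>y. op_adjoint x o\<^sub>L y)"
    unfolding ultraweak_topology_def[of N]
  proof (rule initial_topology_continuous_map_into)
    fix i :: "(nat \<Rightarrow> 'h) \<times> (nat \<Rightarrow> 'h)"
    assume i: "i \<in> {(\<xi>, \<eta>). summable (\<lambda>n. (norm (\<xi> n))\<^sup>2) \<and> summable (\<lambda>n. (norm (\<eta> n))\<^sup>2)}"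
    obtain \<xi> \<eta> where \<xi>\<eta>: "i = (\<xi>, \<eta>)"
      by (cases i)
    have "summable (\<lambda>n. (norm (x (\<xi> n)))\<^sup>2)"
    proof (rule summable_comparison_test')
      show "summable (\<lambda>n. (norm x)\<^sup>2 * (norm (\<xi> n))\<^sup>2)"
        using i \<xi>\<eta> by (auto intro: summable_mult)
      show "norm ((norm (x (\<xi> n)))\<^sup>2) \<le> (norm x)\<^sup>2 * (norm (\<xi> n))\<^sup>2" for n
        using power_mono[OF norm_blinfun[of x "\<xi> n"], of 2] by (simp add: power_mult_distrib)
    qed
    then have mem: "(\<lambda>n. x (\<xi> n), \<eta>) \<in> {(\<xi>, \<eta>). summable (\<lambda>n. (norm (\<xi> n))\<^sup>2) \<and> summable (\<lambda>n. (norm (\<eta> n))\<^sup>2)}"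
      using i \<xi>\<eta> by simp
    show "continuous_map (initial_topology N
        {(\<xi>, \<eta>). summable (\<lambda>n. (norm (\<xi> n))\<^sup>2) \<and> summable (\<lambda>n. (norm (\<eta> n))\<^sup>2)}
        (\<lambda>(\<xi>, \<eta>) x. \<Sum>n. cinner (\<xi> n) (blinfun_apply x (\<eta> n))) euclidean) euclidean
        (\<lambda>t. (\<lambda>(\<xi>, \<eta>) x. \<Sum>n. cinner (\<xi> n) (blinfun_apply x (\<eta> n))) i (op_adjoint x o\<^sub>L t))"
      using initial_topology_continuous_map[OF mem, where f = "\<lambda>(\<xi>, \<eta>) x. \<Sum>n. cinner (\<xi> n) (blinfun_apply x (\<eta> n))"
          and S = N and T = euclidean]
      by (simp add: \<xi>\<eta> op_adjoint_right bounded_op x)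
  qed (use x in \<open>auto simp: initial_topology_topspace intro: compose_mem adjoint_mem\<close>)
  from continuous_map_compose[OF this state_normal]
  have "continuous_map (ultraweak_topology N) euclidean (state_functional x)"
    by (rule continuous_map_eq)
      (simp add: state_functional_def ultraweak_topology_def initial_topology_topspace)
  moreover have "linear_functional_on N (state_functional x)"
  proof -
    have "op_adjoint x o\<^sub>L op_scale c y = op_scale c (op_adjoint x o\<^sub>L y)" for c y
      using op_adjoint(2)[OF bounded_op[OF x]] by (intro blinfun_eqI) (simp add: bounded_op_scaleC)
    moreover have "op_adjoint x o\<^sub>L (y + z) = (op_adjoint x o\<^sub>L y) + (op_adjoint x o\<^sub>L z)"
      for y z :: "'h \<Rightarrow>\<^sub>L 'h"
      by (intro blinfun_eqI) (simp add: blinfun.add_left blinfun.add_right)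
    ultimately show ?thesis
      unfolding linear_functional_on_def state_functional_def using x
      by (simp add: add_mem op_scale_mem state_add state_op_scale
          compose_mem adjoint_mem)
  qed
  ultimately show ?thesis
    by (simp add: predual_def state_functional_def)
qed

text \<open>Evaluate the functional \<open>\<psi> ((x - y)\<^sup>* \<cdot>)\<close> at \<open>x - y\<close>, which has norm at most \<open>2 r\<close>.\<close>

lemma gnorm_le_functional_norm:
  assumes "x \<in> oball r" "y \<in> oball r"
  shows "(gnorm (x - y))\<^sup>2 \<le>
    2 * r * functional_norm N (\<lambda>z. state_functional x z - state_functional y z)"
proof -
  have N: "x \<in> N" "y \<in> N" "x - y \<in> N" and "norm (x - y) \<le> 2 * r"
    using assms norm_triangle_ineq4[of x y] by (auto simp: oball_def intro: diff_mem)
  have "op_adjoint (x - y) o\<^sub>L (x - y) = (op_adjoint x o\<^sub>L (x - y)) - (op_adjoint y o\<^sub>L (x - y))"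
    using N by (intro blinfun_eqI) (simp add: op_adjoint_diff blinfun.diff_left)
  then have "state_functional x (x - y) - state_functional y (x - y) = of_real ((gnorm (x - y))\<^sup>2)"
    using N by (simp add: state_functional_def state_square[symmetric] state_diff compose_mem
        adjoint_mem del: of_real_power)
  then show ?thesis
    using predual_dist_upper[OF state_functional_predual state_functional_predual, of x y "x - y" "2 * r"]
      N \<open>norm (x - y) \<le> 2 * r\<close> by (simp add: norm_power)
qed

text \<open>By the previous estimate, elements of the ball whose functionals \<open>\<psi> (x\<^sup>* \<cdot>)\<close> are close in the
  predual are close in the GNS norm. The functionals of the ball are only a subset of the predual, so
  one chooses an element of the ball with functional near \<open>\<omega>\<close>, if there is one, for each \<open>\<omega>\<close> in a
  countable dense set and each degree of nearness.\<close>

lemma separable_oball: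
  assumes "separable_predual N"
  obtains A where "countable A" "A \<subseteq> oball r"
    "\<And>x e. x \<in> oball r \<Longrightarrow> 0 < e \<Longrightarrow> \<exists>a\<in>A. gnorm (x - a) < e"
proof -
  interpret P: Metric_space "predual N" "\<lambda>\<omega> \<omega>'. if \<omega> \<in> predual N \<and> \<omega>' \<in> predual N
     then functional_norm N (\<lambda>x. \<omega> x - \<omega>' x) else 0"
    by (rule Metric_space_predual)
  obtain D where D: "countable D" "D \<subseteq> predual N" "P.mtopology closure_of D = predual N"
    using assms unfolding separable_predual_def metric_topology_def separable_space_def by auto
  define B where "B \<omega> n = {x \<in> oball r.
    functional_norm N (\<lambda>z. state_functional x z - \<omega> z) < 1 / Suc n}" for \<omega> n
  have "countable (\<Union>\<omega>\<in>D. range (B \<omega>))"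
    using D(1) by simp
  from countable_meeting_set[OF this]
  obtain A where A: "countable A" "A \<subseteq> \<Union>(\<Union>\<omega>\<in>D. range (B \<omega>))"
      "\<forall>X\<in>(\<Union>\<omega>\<in>D. range (B \<omega>)). X \<noteq> {} \<longrightarrow> A \<inter> X \<noteq> {}"
    by (elim exE conjE)
  have "\<exists>a\<in>A. gnorm (x - a) < e" if x: "x \<in> oball r" and e: "0 < e" for x e
  proof -
    have r: "0 \<le> r"
      using x norm_ge_zero[of x] unfolding oball_def by (smt (verit) mem_Collect_eq)
    \<comment> \<open>Two approximations within \<open>1 / (n + 1)\<close> and the factor \<open>2 r\<close> of the estimate give
      \<open>4 r / (n + 1)\<close>.\<close>
    obtain n where n: "4 * r / e\<^sup>2 < real n"
      using reals_Archimedean2 by blast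
    have fx: "state_functional x \<in> predual N"
      using x by (simp add: state_functional_predual oball_def)
    then have "state_functional x \<in> P.mtopology closure_of D"
      using D(3) by blast
    moreover have "0 < 1 / real (Suc n)"
      by simp
    ultimately obtain \<omega> where \<omega>D: "\<omega> \<in> D" "\<omega> \<in> P.mball (state_functional x) (1 / Suc n)"
      unfolding P.metric_closure_of by blast
    then have \<omega>: "\<omega> \<in> D" "functional_norm N (\<lambda>z. state_functional x z - \<omega> z) < 1 / Suc n"
      using D(2) fx by (auto simp: P.in_mball split: if_splits)
    then have "x \<in> B \<omega> n"
      using x by (simp add: B_def)
    then obtain a where a: "a \<in> A" "a \<in> B \<omega> n"
      using A(3) \<omega>(1) by blast
    then have aB: "a \<in> oball r" "functional_norm N (\<lambda>z. state_functional a z - \<omega> z) < 1 / Suc n"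
      by (auto simp: B_def)
    have fa: "state_functional a \<in> predual N"
      using aB by (simp add: state_functional_predual oball_def)
    have "functional_norm N (\<lambda>z. state_functional x z - state_functional a z) < 2 / Suc n"
      using P.triangle'[of "state_functional x" \<omega> "state_functional a"] fx fa \<omega> D(2) aB(2) by auto
    then have "2 * r * functional_norm N (\<lambda>z. state_functional x z - state_functional a z)
        \<le> 2 * r * (2 / Suc n)"
      using r by (intro mult_left_mono) auto
    then have "(gnorm (x - a))\<^sup>2 \<le> 2 * r * (2 / Suc n)"
      using gnorm_le_functional_norm[OF x aB(1)] by linarith
    also have "\<dots> < e\<^sup>2"
    proof -
      have "4 * r < real n * e\<^sup>2"
        using n e by (simp add: field_simps)
      also have "\<dots> \<le> real (Suc n) * e\<^sup>2"
        by (intro mult_right_mono) auto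
      finally show ?thesis
        by (simp add: field_simps)
    qed
    finally show ?thesis
      using a(1) e power_less_imp_less_base by fastforce
  qed
  moreover have "A \<subseteq> oball r"
    using A(2) by (auto simp: B_def)
  ultimately show ?thesis
    using that A(1) by blast
qed

lemma separable_gnorm:
  assumes "separable_predual N"
  obtains D where "countable D" "D \<subseteq> N" "\<And>x e. x \<in> N \<Longrightarrow> 0 < e \<Longrightarrow> \<exists>d\<in>D. gnorm (x - d) < e"
proof -
  have "\<exists>A. countable A \<and> A \<subseteq> oball r \<and> (\<forall>x\<in>oball r. \<forall>e>0. \<exists>a\<in>A. gnorm (x - a) < e)" for r
    using separable_oball[OF assms, of r] by metis
  then obtain A where A: "\<And>r. countable (A r)" "\<And>r. A r \<subseteq> oball r"
      "\<And>r x e. x \<in> oball r \<Longrightarrow> 0 < e \<Longrightarrow> \<exists>a\<in>A r. gnorm (x - a) < e"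
    by metis
  show ?thesis
  proof (rule that[of "\<Union>n::nat. A (real n)"])
    show "\<exists>d\<in>\<Union>n. A (real n). gnorm (x - d) < e" if "x \<in> N" "0 < e" for x e
    proof -
      obtain n where "norm x \<le> real n"
        using real_arch_simple by blast
      then show ?thesis
        using A(3)[of x "real n" e] that by (auto simp: oball_def)
    qed
  qed (use A in \<open>auto simp: oball_def\<close>)
qed

end

section \<open>The GNS Hilbert space and the strong topology\<close>

context normal_state
begin

lemma gnorm_reverse_triangle:
  assumes "x \<in> N" "y \<in> N"
  shows "\<bar>gnorm x - gnorm y\<bar> \<le> gnorm (x - y)"
  using gnorm_triangle[of "x - y" y] gnorm_triangle[of "y - x" x] gnorm_diff_commute[OF assms] assms
  by (simp add: diff_mem abs_le_iff)

lemma gns_Cauchy_mem: "y \<in> gns_Cauchy N \<psi> \<Longrightarrow> y n \<in> N"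
  by (auto simp: gns_Cauchy_def)

lemma gns_CauchyD:
  assumes "y \<in> gns_Cauchy N \<psi>" "0 < e"
  shows "\<exists>m. \<forall>i\<ge>m. \<forall>j\<ge>m. gnorm (y i - y j) < e"
  using assms by (simp add: gns_Cauchy_def)

lemma gns_relD: "(y, z) \<in> gns_rel N \<psi> \<Longrightarrow> (\<lambda>n. gnorm (y n - z n)) \<longlonglongrightarrow> 0"
  by (simp add: gns_rel_def)

lemma equiv_gns_rel: "equiv (gns_Cauchy N \<psi>) (gns_rel N \<psi>)"
proof (rule equivI)
  show "gns_rel N \<psi> \<subseteq> gns_Cauchy N \<psi> \<times> gns_Cauchy N \<psi>"
    by (auto simp: gns_rel_def)
  show "refl_on (gns_Cauchy N \<psi>) (gns_rel N \<psi>)"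
    by (auto simp: refl_on_def gns_rel_def)
  show "sym (gns_rel N \<psi>)"
    by (auto simp: sym_def gns_rel_def gnorm_diff_commute gns_Cauchy_mem)
  show "trans (gns_rel N \<psi>)"
  proof (rule transI)
    fix x y z
    assume xy: "(x, y) \<in> gns_rel N \<psi>" and yz: "(y, z) \<in> gns_rel N \<psi>"
    then have mem: "x n \<in> N" "y n \<in> N" "z n \<in> N" for n
      by (auto simp: gns_rel_def gns_Cauchy_mem)
    have "(\<lambda>n. gnorm (x n - z n)) \<longlonglongrightarrow> 0"
    proof (rule Lim_null_comparison)
      show "\<forall>\<^sub>F n in sequentially. norm (gnorm (x n - z n)) \<le> gnorm (x n - y n) + gnorm (y n - z n)"
        using mem by (simp add: gnorm_nonneg diff_mem gnorm_diff_triangle)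
      show "(\<lambda>n. gnorm (x n - y n) + gnorm (y n - z n)) \<longlonglongrightarrow> 0"
        using tendsto_add[OF gns_relD[OF xy] gns_relD[OF yz]] by simp
    qed
    then show "(x, z) \<in> gns_rel N \<psi>"
      using xy yz by (simp add: gns_rel_def)
  qed
qed

lemma gns_class_mem:
  assumes "\<xi> \<in> gns_space N \<psi>" "y \<in> \<xi>"
  shows "y \<in> gns_Cauchy N \<psi>"
  using assms in_quotient_imp_subset[OF equiv_gns_rel] unfolding gns_space_def by blast

lemma gns_space_rep: "\<xi> \<in> gns_space N \<psi> \<Longrightarrow> (SOME y. y \<in> \<xi>) \<in> \<xi>"
  using in_quotient_imp_non_empty[OF equiv_gns_rel] unfolding gns_space_def by (simp add: some_in_eq)

lemma gns_class_rel: "\<xi> \<in> gns_space N \<psi> \<Longrightarrow> y \<in> \<xi> \<Longrightarrow> z \<in> \<xi> \<Longrightarrow> (y, z) \<in> gns_rel N \<psi>"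
  using in_quotient_imp_in_rel[OF equiv_gns_rel] unfolding gns_space_def by blast

text \<open>The limit defining the distance of two classes exists, and any representatives compute it.\<close>

lemma gns_dist_tendsto:
  assumes \<xi>: "\<xi> \<in> gns_space N \<psi>" "y \<in> \<xi>" and \<eta>: "\<eta> \<in> gns_space N \<psi>" "z \<in> \<eta>"
  shows "(\<lambda>n. gnorm (y n - z n)) \<longlonglongrightarrow> gns_dist \<psi> \<xi> \<eta>"
proof -
  define y' z' where "y' = (SOME y. y \<in> \<xi>)" and "z' = (SOME z. z \<in> \<eta>)"
  have y': "y' \<in> \<xi>" and z': "z' \<in> \<eta>"
    unfolding y'_def z'_def by (rule gns_space_rep[OF \<xi>(1)], rule gns_space_rep[OF \<eta>(1)])
  have C: "y \<in> gns_Cauchy N \<psi>" "y' \<in> gns_Cauchy N \<psi>" "z \<in> gns_Cauchy N \<psi>" "z' \<in> gns_Cauchy N \<psi>"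
    using gns_class_mem \<xi> \<eta> y' z' by blast+
  then have mem: "y n \<in> N" "y' n \<in> N" "z n \<in> N" "z' n \<in> N" for n
    by (auto intro: gns_Cauchy_mem)
  have close: "\<bar>gnorm (a - b) - gnorm (a' - b')\<bar> \<le> gnorm (a - a') + gnorm (b - b')"
    if "a \<in> N" "a' \<in> N" "b \<in> N" "b' \<in> N" for a a' b b'
  proof -
    have "\<bar>gnorm (a - b) - gnorm (a' - b')\<bar> \<le> gnorm ((a - b) - (a' - b'))"
      by (intro gnorm_reverse_triangle diff_mem that)
    also have "(a - b) - (a' - b') = (a - a') + (b' - b)"
      by simp
    also have "gnorm ((a - a') + (b' - b)) \<le> gnorm (a - a') + gnorm (b' - b)"
      by (intro gnorm_triangle diff_mem that)
    finally show ?thesis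
      using gnorm_diff_commute[OF that(3,4)] by simp
  qed
  have "Cauchy (\<lambda>n. gnorm (y' n - z' n))"
  proof (rule metric_CauchyI)
    fix e :: real
    assume "0 < e"
    then have e: "0 < e / 2"
      by simp
    obtain m1 where m1: "\<And>i j. m1 \<le> i \<Longrightarrow> m1 \<le> j \<Longrightarrow> gnorm (y' i - y' j) < e / 2"
      using gns_CauchyD[OF C(2) e] by blast
    obtain m2 where m2: "\<And>i j. m2 \<le> i \<Longrightarrow> m2 \<le> j \<Longrightarrow> gnorm (z' i - z' j) < e / 2"
      using gns_CauchyD[OF C(4) e] by blast
    have "dist (gnorm (y' i - z' i)) (gnorm (y' j - z' j)) < e" if "max m1 m2 \<le> i" "max m1 m2 \<le> j" for i j
      using close[OF mem(2)[of i] mem(2)[of j] mem(4)[of i] mem(4)[of j]] m1[of i j] m2[of i j] that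
      by (simp add: dist_real_def)
    then show "\<exists>M. \<forall>i\<ge>M. \<forall>j\<ge>M. dist (gnorm (y' i - z' i)) (gnorm (y' j - z' j)) < e"
      by blast
  qed
  then have lim: "(\<lambda>n. gnorm (y' n - z' n)) \<longlonglongrightarrow> gns_dist \<psi> \<xi> \<eta>"
    unfolding gns_dist_def y'_def z'_def by (simp add: Cauchy_convergent_iff convergent_LIMSEQ_iff)
  have "(\<lambda>n. gnorm (y n - z n) - gnorm (y' n - z' n)) \<longlonglongrightarrow> 0"
  proof (rule Lim_null_comparison)
    show "\<forall>\<^sub>F n in sequentially. norm (gnorm (y n - z n) - gnorm (y' n - z' n))
        \<le> gnorm (y n - y' n) + gnorm (z n - z' n)"
      using close mem by simp
    show "(\<lambda>n. gnorm (y n - y' n) + gnorm (z n - z' n)) \<longlonglongrightarrow> 0"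
      using tendsto_add[OF gns_relD[OF gns_class_rel[OF \<xi>(1,2) y']] gns_relD[OF gns_class_rel[OF \<eta>(1,2) z']]]
      by simp
  qed
  from tendsto_add[OF this lim] show ?thesis
    by simp
qed

lemma Metric_space_gns:
  "Metric_space (gns_space N \<psi>)
     (\<lambda>\<xi> \<eta>. if \<xi> \<in> gns_space N \<psi> \<and> \<eta> \<in> gns_space N \<psi> then gns_dist \<psi> \<xi> \<eta> else 0)"
    (is "Metric_space ?S ?d")
proof
  note rep = gns_space_rep
  have mem: "(SOME y. y \<in> \<xi>) n \<in> N" if "\<xi> \<in> ?S" for \<xi> n
    using gns_Cauchy_mem[OF gns_class_mem[OF that rep[OF that]]] .
  show "0 \<le> ?d \<xi> \<eta>" for \<xi> \<eta>
    using gns_dist_tendsto[of \<xi> _ \<eta>, OF _ rep _ rep] mem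
    by (auto intro!: LIMSEQ_le_const gnorm_nonneg diff_mem)
  show "?d \<xi> \<eta> = ?d \<eta> \<xi>" for \<xi> \<eta>
    using mem by (simp add: gns_dist_def gnorm_diff_commute)
  show "?d \<xi> \<eta> = 0 \<longleftrightarrow> \<xi> = \<eta>" if \<xi>: "\<xi> \<in> ?S" and \<eta>: "\<eta> \<in> ?S" for \<xi> \<eta>
  proof
    assume "?d \<xi> \<eta> = 0"
    then have "((SOME y. y \<in> \<xi>), (SOME y. y \<in> \<eta>)) \<in> gns_rel N \<psi>"
      using gns_dist_tendsto[OF \<xi> rep[OF \<xi>] \<eta> rep[OF \<eta>]] \<xi> \<eta>
        gns_class_mem[OF \<xi> rep[OF \<xi>]] gns_class_mem[OF \<eta> rep[OF \<eta>]]
      by (simp add: gns_rel_def)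
    then show "\<xi> = \<eta>"
      using quotient_eqI[OF equiv_gns_rel _ _ rep[OF \<xi>] rep[OF \<eta>]] \<xi> \<eta>
      by (simp add: gns_space_def)
  next
    assume "\<xi> = \<eta>"
    then show "?d \<xi> \<eta> = 0"
      by (simp add: gns_dist_def)
  qed
  show "?d \<xi> \<zeta> \<le> ?d \<xi> \<eta> + ?d \<eta> \<zeta>" if S: "\<xi> \<in> ?S" "\<eta> \<in> ?S" "\<zeta> \<in> ?S" for \<xi> \<eta> \<zeta>
  proof -
    note lim = gns_dist_tendsto[OF _ rep _ rep]
    have "gns_dist \<psi> \<xi> \<zeta> \<le> gns_dist \<psi> \<xi> \<eta> + gns_dist \<psi> \<eta> \<zeta>"
      by (rule LIMSEQ_le[OF lim[OF S(1) S(1) S(3) S(3)]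
            tendsto_add[OF lim[OF S(1) S(1) S(2) S(2)] lim[OF S(2) S(2) S(3) S(3)]]])
        (use mem S in \<open>auto intro!: gnorm_diff_triangle\<close>)
    then show ?thesis
      using S by simp
  qed
qed

lemma gns_Cauchy_left_mult:
  assumes x: "x \<in> N" and y: "y \<in> gns_Cauchy N \<psi>"
  shows "(\<lambda>n. x o\<^sub>L y n) \<in> gns_Cauchy N \<psi>"
proof -
  have diff: "gnorm ((x o\<^sub>L y i) - (x o\<^sub>L y j)) \<le> norm x * gnorm (y i - y j)" for i j
  proof -
    have "(x o\<^sub>L y i) - (x o\<^sub>L y j) = (x o\<^sub>L (y i - y j))"
      by (rule blinfun_eqI) (simp add: blinfun.diff_left blinfun.diff_right)
    then show ?thesis
      using gnorm_left_mult[OF x diff_mem[OF gns_Cauchy_mem[OF y] gns_Cauchy_mem[OF y]]] by simp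
  qed
  have "\<exists>m. \<forall>i\<ge>m. \<forall>j\<ge>m. gnorm ((x o\<^sub>L y i) - (x o\<^sub>L y j)) < e" if e: "0 < e" for e
  proof -
    have "0 < e / (norm x + 1)"
      using e by (simp add: add_nonneg_pos)
    then obtain m where m: "\<And>i j. m \<le> i \<Longrightarrow> m \<le> j \<Longrightarrow> gnorm (y i - y j) < e / (norm x + 1)"
      using gns_CauchyD[OF y] by blast
    have "norm x * gnorm (y i - y j) < e" if "m \<le> i" "m \<le> j" for i j
    proof -
      have "norm x * gnorm (y i - y j) \<le> norm x * (e / (norm x + 1))"
        using m[OF that] by (intro mult_left_mono) auto
      also have "\<dots> < e"
      proof -
        have "0 < norm x + 1"
          by (simp add: add_nonneg_pos)
        then show ?thesis
          using e by (simp add: pos_divide_less_eq algebra_simps)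
      qed
      finally show ?thesis .
    qed
    then show ?thesis
      using diff order_le_less_trans by blast
  qed
  then show ?thesis
    using x gns_Cauchy_mem[OF y] by (auto simp: gns_Cauchy_def intro: compose_mem)
qed

lemma gns_action_mem:
  assumes x: "x \<in> N" and \<xi>: "\<xi> \<in> gns_space N \<psi>"
  shows "gns_action N \<psi> x \<xi> \<in> gns_space N \<psi>"
    and "(\<lambda>n. x o\<^sub>L (SOME y. y \<in> \<xi>) n) \<in> gns_action N \<psi> x \<xi>"
proof -
  have c: "(\<lambda>n. x o\<^sub>L (SOME y. y \<in> \<xi>) n) \<in> gns_Cauchy N \<psi>"
    by (intro gns_Cauchy_left_mult x gns_class_mem[OF \<xi>] gns_space_rep \<xi>)
  show "gns_action N \<psi> x \<xi> \<in> gns_space N \<psi>"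
    unfolding gns_action_def gns_space_def by (rule quotientI[OF c])
  show "(\<lambda>n. x o\<^sub>L (SOME y. y \<in> \<xi>) n) \<in> gns_action N \<psi> x \<xi>"
    unfolding gns_action_def by (rule equiv_class_self[OF equiv_gns_rel c])
qed

lemma gns_dist_action_tendsto:
  assumes x: "x \<in> N" "x' \<in> N" and \<xi>: "\<xi> \<in> gns_space N \<psi>"
  shows "(\<lambda>n. gnorm ((x - x') o\<^sub>L (SOME y. y \<in> \<xi>) n))
    \<longlonglongrightarrow> gns_dist \<psi> (gns_action N \<psi> x \<xi>) (gns_action N \<psi> x' \<xi>)"
proof -
  have "(x o\<^sub>L y) - (x' o\<^sub>L y) = ((x - x') o\<^sub>L y)" for y :: "'h \<Rightarrow>\<^sub>L 'h"
    by (rule blinfun_eqI) (simp add: blinfun.diff_left)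
  then show ?thesis
    using gns_dist_tendsto[OF gns_action_mem[OF x(1) \<xi>] gns_action_mem[OF x(2) \<xi>]] by simp
qed

text \<open>The cyclic vector \<open>\<Omega>\<close>, with \<open>\<parallel>x \<Omega>\<parallel> = \<parallel>x\<parallel>\<^sub>\<psi>\<close>.\<close>

definition gns_cyclic :: "(nat \<Rightarrow> ('h \<Rightarrow>\<^sub>L 'h)) set" where
  "gns_cyclic = gns_rel N \<psi> `` {\<lambda>_. id_blinfun}"

lemma gns_cyclic_mem: "gns_cyclic \<in> gns_space N \<psi>" "(\<lambda>_. id_blinfun) \<in> gns_cyclic"
proof -
  have c: "(\<lambda>_. id_blinfun) \<in> gns_Cauchy N \<psi>"
    by (simp add: gns_Cauchy_def id_mem)
  show "gns_cyclic \<in> gns_space N \<psi>"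
    unfolding gns_cyclic_def gns_space_def by (rule quotientI[OF c])
  show "(\<lambda>_. id_blinfun) \<in> gns_cyclic"
    unfolding gns_cyclic_def by (rule equiv_class_self[OF equiv_gns_rel c])
qed

lemma gns_dist_action_cyclic:
  assumes x: "x \<in> N" "x' \<in> N"
  shows "gns_dist \<psi> (gns_action N \<psi> x gns_cyclic) (gns_action N \<psi> x' gns_cyclic) = gnorm (x - x')"
proof (rule LIMSEQ_unique[OF gns_dist_action_tendsto[OF x gns_cyclic_mem(1)]])
  define y where "y = (SOME y. y \<in> gns_cyclic)"
  have y: "y \<in> gns_cyclic"
    unfolding y_def by (rule gns_space_rep[OF gns_cyclic_mem(1)])
  have mem: "y n \<in> N" for n
    by (rule gns_Cauchy_mem[OF gns_class_mem[OF gns_cyclic_mem(1) y]])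
  have z: "x - x' \<in> N"
    using x by (rule diff_mem)
  have "(\<lambda>n. gnorm ((x - x') o\<^sub>L y n) - gnorm (x - x')) \<longlonglongrightarrow> 0"
  proof (rule Lim_null_comparison)
    have "norm (gnorm ((x - x') o\<^sub>L y n) - gnorm (x - x')) \<le> norm (x - x') * gnorm (y n - id_blinfun)" for n
    proof -
      have "((x - x') o\<^sub>L y n) - (x - x') = ((x - x') o\<^sub>L (y n - id_blinfun))"
        by (rule blinfun_eqI) (simp add: blinfun.diff_left blinfun.diff_right)
      then have "norm (gnorm ((x - x') o\<^sub>L y n) - gnorm (x - x'))
          \<le> gnorm ((x - x') o\<^sub>L (y n - id_blinfun))"
        using gnorm_reverse_triangle[OF compose_mem[OF z mem[of n]] z] by simp
      also have "\<dots> \<le> norm (x - x') * gnorm (y n - id_blinfun)"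
        by (intro gnorm_left_mult z diff_mem mem id_mem)
      finally show ?thesis .
    qed
    then show "\<forall>\<^sub>F n in sequentially. norm (gnorm ((x - x') o\<^sub>L y n) - gnorm (x - x'))
        \<le> norm (x - x') * gnorm (y n - id_blinfun)"
      by simp
    show "(\<lambda>n. norm (x - x') * gnorm (y n - id_blinfun)) \<longlonglongrightarrow> 0"
      using tendsto_mult_left[OF gns_relD[OF gns_class_rel[OF gns_cyclic_mem(1) y gns_cyclic_mem(2)]]]
      by simp
  qed
  then show "(\<lambda>n. gnorm ((x - x') o\<^sub>L (SOME y. y \<in> gns_cyclic) n)) \<longlonglongrightarrow> gnorm (x - x')"
    unfolding y_def[symmetric] by (simp add: LIM_zero_iff)
qed

text \<open>Vectors of the form \<open>y\<Omega>\<close>, \<open>y \<in> N\<close>, are dense and \<open>x\<close>, \<open>x'\<close> are bounded, so that the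
  continuity of right multiplication by \<open>y\<close> on bounded sets suffices.\<close>

lemma gns_action_continuous_on_bounded:
  assumes \<xi>: "\<xi> \<in> gns_space N \<psi>" and e: "0 < e"
  shows "\<exists>\<delta>>0. \<forall>x\<in>oball C. \<forall>x'\<in>oball C. gnorm (x - x') < \<delta> \<longrightarrow>
    gns_dist \<psi> (gns_action N \<psi> x \<xi>) (gns_action N \<psi> x' \<xi>) < e"
proof -
  define y where "y = (SOME y. y \<in> \<xi>)"
  have y: "y \<in> gns_Cauchy N \<psi>"
    unfolding y_def by (rule gns_class_mem[OF \<xi> gns_space_rep[OF \<xi>]])
  have mem: "y n \<in> N" for n
    by (rule gns_Cauchy_mem[OF y])
  \<comment> \<open>A positive bound for \<open>\<parallel>x - x'\<parallel>\<close>.\<close>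
  define K where "K = 2 * \<bar>C\<bar> + 1"
  have K: "0 < K"
    by (simp add: K_def add_nonneg_pos)
  have "0 < e / (4 * K)"
    using e K by simp
  then obtain m where m: "\<And>i j. m \<le> i \<Longrightarrow> m \<le> j \<Longrightarrow> gnorm (y i - y j) < e / (4 * K)"
    using gns_CauchyD[OF y] by blast
  have "0 < e / 4"
    using e by simp
  then obtain \<delta> where \<delta>: "0 < \<delta>"
      "\<And>z. z \<in> N \<Longrightarrow> norm z \<le> K \<Longrightarrow> gnorm z < \<delta> \<Longrightarrow> gnorm (z o\<^sub>L y m) < e / 4"
    using right_mult_continuous_on_bounded[OF mem, of "e / 4" K m] by blast
  have "gns_dist \<psi> (gns_action N \<psi> x \<xi>) (gns_action N \<psi> x' \<xi>) < e"
    if x: "x \<in> oball C" "x' \<in> oball C" "gnorm (x - x') < \<delta>" for x x'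
  proof -
    have N: "x \<in> N" "x' \<in> N" and z: "x - x' \<in> N" and zK: "norm (x - x') \<le> K"
      using x norm_triangle_ineq4[of x x'] by (auto simp: oball_def K_def intro: diff_mem)
    have bound: "gnorm ((x - x') o\<^sub>L y n) \<le> e / 2" if n: "m \<le> n" for n
    proof -
      have "((x - x') o\<^sub>L y n) = ((x - x') o\<^sub>L y m) + ((x - x') o\<^sub>L (y n - y m))"
        by (rule blinfun_eqI) (simp add: blinfun.add_left blinfun.diff_left blinfun.diff_right)
      then have "gnorm ((x - x') o\<^sub>L y n) \<le> gnorm ((x - x') o\<^sub>L y m) + gnorm ((x - x') o\<^sub>L (y n - y m))"
        using gnorm_triangle[OF compose_mem[OF z mem] compose_mem[OF z diff_mem[OF mem mem]]] by simp
      also have "gnorm ((x - x') o\<^sub>L y m) \<le> e / 4"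
        using \<delta>(2)[OF z zK x(3)] by simp
      also have "gnorm ((x - x') o\<^sub>L (y n - y m)) \<le> norm (x - x') * gnorm (y n - y m)"
        by (intro gnorm_left_mult z diff_mem mem)
      also have "\<dots> \<le> K * (e / (4 * K))"
        using zK m[OF n order_refl] K gnorm_nonneg[OF diff_mem[OF mem mem]]
        by (intro mult_mono) auto
      finally show ?thesis
        using K by simp
    qed
    have "gns_dist \<psi> (gns_action N \<psi> x \<xi>) (gns_action N \<psi> x' \<xi>) \<le> e / 2"
      using gns_dist_action_tendsto[OF N \<xi>] bound
      by (intro LIMSEQ_le_const2) (auto simp: y_def)
    then show ?thesis
      using e by simp
  qed
  then show ?thesis
    using \<delta>(1) by blast
qed

lemma topspace_gns [simp]:
  "topspace (metric_topology (gns_space N \<psi>) (gns_dist \<psi>)) = gns_space N \<psi>"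
  unfolding metric_topology_def by (rule Metric_space.topspace_mtopology[OF Metric_space_gns])

lemma topspace_strong [simp]: "topspace (strong_topology N \<psi>) = N"
  by (simp add: strong_topology_def initial_topology_topspace)

text \<open>Evaluation at the cyclic vector turns the GNS metric into one of the seminorms of the strong
  topology.\<close>

lemma strong_topology_ball_nhd:
  assumes "x \<in> N" "0 < e"
  obtains V where "openin (strong_topology N \<psi>) V" "x \<in> V" "\<And>y. y \<in> V \<Longrightarrow> gnorm (x - y) < e"
proof -
  interpret G: Metric_space "gns_space N \<psi>"
    "\<lambda>\<xi> \<eta>. if \<xi> \<in> gns_space N \<psi> \<and> \<eta> \<in> gns_space N \<psi> then gns_dist \<psi> \<xi> \<eta> else 0"
    by (rule Metric_space_gns)
  define U where "U = G.mball (gns_action N \<psi> x gns_cyclic) e"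
  have "continuous_map (strong_topology N \<psi>) (metric_topology (gns_space N \<psi>) (gns_dist \<psi>))
      (\<lambda>x. gns_action N \<psi> x gns_cyclic)"
    unfolding strong_topology_def
    by (rule initial_topology_continuous_map[where f = "\<lambda>\<xi> x. gns_action N \<psi> x \<xi>"])
      (auto simp: gns_cyclic_mem gns_action_mem)
  moreover have "openin (metric_topology (gns_space N \<psi>) (gns_dist \<psi>)) U"
    unfolding metric_topology_def U_def by (rule G.openin_mball)
  ultimately have "openin (strong_topology N \<psi>) {y \<in> N. gns_action N \<psi> y gns_cyclic \<in> U}"
    using openin_continuous_map_preimage by fastforce
  then show ?thesis
  proof (rule that)
    show "x \<in> {y \<in> N. gns_action N \<psi> y gns_cyclic \<in> U}"
      using assms by (simp add: U_def gns_action_mem gns_cyclic_mem del: G.in_mball)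
    show "gnorm (x - y) < e" if "y \<in> {y \<in> N. gns_action N \<psi> y gns_cyclic \<in> U}" for y
      using that assms(1) gns_dist_action_cyclic[of x y]
      by (auto simp: U_def gns_action_mem gns_cyclic_mem)
  qed
qed

end

section \<open>State-preserving ucp maps\<close>

locale state_pair = M: normal_state M \<phi> + N: normal_state N \<psi>
  for M :: "('h::chilbert_space \<Rightarrow>\<^sub>L 'h) set" and \<phi> and N :: "('k::chilbert_space \<Rightarrow>\<^sub>L 'k) set" and \<psi>
begin

abbreviation ucp_maps :: "(('h \<Rightarrow>\<^sub>L 'h) \<Rightarrow> ('k \<Rightarrow>\<^sub>L 'k)) set" where
  "ucp_maps \<equiv> state_preserving_ucp_maps M \<phi> N \<psi>"

lemma
  assumes "\<Phi> \<in> ucp_maps"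
  shows ucp_extensional: "\<Phi> \<in> M \<rightarrow>\<^sub>E N"
    and ucp_mem: "\<And>x. x \<in> M \<Longrightarrow> \<Phi> x \<in> N"
    and ucp_add: "\<And>x y. x \<in> M \<Longrightarrow> y \<in> M \<Longrightarrow> \<Phi> (x + y) = \<Phi> x + \<Phi> y"
    and ucp_op_scale: "\<And>c x. x \<in> M \<Longrightarrow> \<Phi> (op_scale c x) = op_scale c (\<Phi> x)"
    and ucp_id: "\<Phi> id_blinfun = id_blinfun"
    and ucp_state: "\<And>x. x \<in> M \<Longrightarrow> \<psi> (\<Phi> x) = \<phi> x"
    and ucp_positive_matrix: "\<And>n x. (\<And>i j. i < n \<Longrightarrow> j < n \<Longrightarrow> x i j \<in> M) \<Longrightarrow> positive_matrix n x \<Longrightarrow>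
      positive_matrix n (\<lambda>i j. \<Phi> (x i j))"
  using assms unfolding state_preserving_ucp_maps_def ucp_map_def by auto

lemma ucp_diff:
  assumes "\<Phi> \<in> ucp_maps" "x \<in> M" "y \<in> M"
  shows "\<Phi> (x - y) = \<Phi> x - \<Phi> y"
  using ucp_add[OF assms(1) M.diff_mem[OF assms(2,3)] assms(3)] by simp

lemma ucp_positive:
  assumes "\<Phi> \<in> ucp_maps" "x \<in> M" "positive_op x"
  shows "positive_op (\<Phi> x)"
proof -
  have "positive_matrix 1 (\<lambda>i j. \<Phi> x)"
    using assms by (intro ucp_positive_matrix) (simp_all add: positive_matrix_def positive_op_def)
  then have "cinner \<xi> (\<Phi> x \<xi>) \<in> \<real>\<^sub>\<ge>\<^sub>0" for \<xi>
    unfolding positive_matrix_def by (auto dest: spec[of _ "\<lambda>_. \<xi>"])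
  then show ?thesis
    by (simp add: positive_op_def)
qed

text \<open>The Kadison--Schwarz inequality \<open>\<Phi>(x)\<^sup>*\<Phi>(x) \<le> \<Phi>(x\<^sup>* x)\<close>, evaluated at a vector. The operator
  matrix with rows \<open>(1, x)\<close> and \<open>(x\<^sup>*, x\<^sup>* x)\<close> is positive, its quadratic form being
  \<open>\<parallel>\<zeta>\<^sub>0 + x\<zeta>\<^sub>1\<parallel>\<^sup>2\<close>; the Cauchy--Schwarz inequality for the form of its image under \<open>\<Phi>\<close> gives
  \<open>\<bar>\<langle>\<eta>, \<Phi>(x)\<zeta>\<rangle>\<bar>\<^sup>2 \<le> \<parallel>\<eta>\<parallel>\<^sup>2 \<langle>\<zeta>, \<Phi>(x\<^sup>* x)\<zeta>\<rangle>\<close>, and one takes \<open>\<eta> = \<Phi>(x)\<zeta>\<close>.\<close>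

lemma ucp_Schwarz:
  assumes \<Phi>: "\<Phi> \<in> ucp_maps" and x: "x \<in> M"
  shows "cinner \<zeta> (\<Phi> (op_adjoint x o\<^sub>L x) \<zeta>) \<in> \<real>\<^sub>\<ge>\<^sub>0"
    and "(norm (\<Phi> x \<zeta>))\<^sup>2 \<le> Re (cinner \<zeta> (\<Phi> (op_adjoint x o\<^sub>L x) \<zeta>))"
proof -
  define m where "m i j = (if i = (0::nat) then if j = (0::nat) then id_blinfun else x
    else if j = 0 then op_adjoint x else op_adjoint x o\<^sub>L x)" for i j
  have "positive_matrix 2 m"
    unfolding positive_matrix_def
  proof
    fix \<xi> :: "nat \<Rightarrow> 'h"
    have "(\<Sum>i<2. cinner (\<xi> i) (\<Sum>j<2. m i j (\<xi> j))) = cinner (\<xi> 0 + x (\<xi> 1)) (\<xi> 0 + x (\<xi> 1))"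
      by (simp add: numeral_2_eq_2 m_def cinner.add_left cinner.add_right
          op_adjoint_right M.bounded_op x)
    then show "(\<Sum>i<2. cinner (\<xi> i) (\<Sum>j<2. m i j (\<xi> j))) \<in> \<real>\<^sub>\<ge>\<^sub>0"
      by (simp add: cinner_self del: of_real_power)
  qed
  moreover have "m i j \<in> M" for i j
    using x by (simp add: m_def M.id_mem M.adjoint_mem M.compose_mem)
  ultimately have "positive_matrix 2 (\<lambda>i j. \<Phi> (m i j))"
    by (intro ucp_positive_matrix[OF \<Phi>])
  then have pos: "(\<Sum>i<2. cinner (\<xi> i) (\<Sum>j<2. \<Phi> (m i j) (\<xi> j))) \<in> \<real>\<^sub>\<ge>\<^sub>0" for \<xi>
    by (simp add: positive_matrix_def)
  have form: "cinner \<eta> \<eta> + c * cinner \<eta> (\<Phi> x \<zeta>) + cnj c * cinner \<zeta> (\<Phi> (op_adjoint x) \<eta>)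
      + c * cnj c * cinner \<zeta> (\<Phi> (op_adjoint x o\<^sub>L x) \<zeta>) \<in> \<real>\<^sub>\<ge>\<^sub>0" for \<eta> c
    using pos[of "\<lambda>i. if i = 0 then \<eta> else scaleC c \<zeta>"]
      ucp_mem[OF \<Phi> x, THEN N.bounded_op]
      ucp_mem[OF \<Phi> M.compose_mem[OF M.adjoint_mem[OF x] x], THEN N.bounded_op]
    by (simp add: numeral_2_eq_2 m_def ucp_id[OF \<Phi>] bounded_op_scaleC cinner.add_right
        cinner_scaleC_right cinner_scaleC_left algebra_simps)
  show q: "cinner \<zeta> (\<Phi> (op_adjoint x o\<^sub>L x) \<zeta>) \<in> \<real>\<^sub>\<ge>\<^sub>0"
    using form[of 0 1] by (simp add: cinner.zero_left cinner.zero_right)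
  define \<eta> where "\<eta> = \<Phi> x \<zeta>"
  have "((norm \<eta>)\<^sup>2)\<^sup>2 \<le> (norm \<eta>)\<^sup>2 * Re (cinner \<zeta> (\<Phi> (op_adjoint x o\<^sub>L x) \<zeta>))"
    using nonneg_quadratic_form(2)[OF form[of \<eta>] q]
    by (simp add: \<eta>_def[symmetric] cinner_self norm_power)
  then show "(norm (\<Phi> x \<zeta>))\<^sup>2 \<le> Re (cinner \<zeta> (\<Phi> (op_adjoint x o\<^sub>L x) \<zeta>))"
    using q unfolding \<eta>_def[symmetric]
    by (cases "\<eta> = 0") (simp_all add: complex_nonneg_Reals_iff power2_eq_square)
qed

text \<open>Positivity of \<open>\<Phi>\<close> at \<open>\<parallel>x\<parallel>\<^sup>2 - x\<^sup>* x\<close> bounds the right hand side of the Kadison--Schwarz inequality.\<close>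

lemma ucp_norm_le:
  assumes \<Phi>: "\<Phi> \<in> ucp_maps" and x: "x \<in> M"
  shows "norm (\<Phi> x) \<le> norm x"
proof (rule norm_blinfun_bound)
  fix \<zeta>
  let ?X = "op_adjoint x o\<^sub>L x" and ?I = "op_scale (of_real ((norm x)\<^sup>2)) id_blinfun"
  have X: "?X \<in> M" and I: "?I \<in> M"
    using x by (auto intro: M.compose_mem M.adjoint_mem M.op_scale_mem M.id_mem)
  have "positive_op (?I - ?X)"
    unfolding positive_op_def
  proof
    fix \<xi>
    have "cinner \<xi> ((?I - ?X) \<xi>) = of_real ((norm x * norm \<xi>)\<^sup>2 - (norm (x \<xi>))\<^sup>2)"
      by (simp add: blinfun.diff_left cinner.diff_right cinner_scaleC_right op_adjoint_right
          M.bounded_op x cinner_self power_mult_distrib)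
    moreover have "(norm (x \<xi>))\<^sup>2 \<le> (norm x * norm \<xi>)\<^sup>2"
      by (intro power_mono norm_blinfun) simp
    ultimately show "cinner \<xi> ((?I - ?X) \<xi>) \<in> \<real>\<^sub>\<ge>\<^sub>0"
      by (simp only: nonneg_Reals_of_real_iff diff_ge_0_iff_ge)
  qed
  then have "positive_op (\<Phi> (?I - ?X))"
    using \<Phi> X I by (intro ucp_positive M.diff_mem)
  moreover have "\<Phi> (?I - ?X) = op_scale (of_real ((norm x)\<^sup>2)) id_blinfun - \<Phi> ?X"
    by (simp add: ucp_diff[OF \<Phi> I X] ucp_op_scale[OF \<Phi> M.id_mem] ucp_id[OF \<Phi>] del: of_real_power)
  ultimately have "Re (cinner \<zeta> (\<Phi> ?X \<zeta>)) \<le> (norm x * norm \<zeta>)\<^sup>2"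
    by (simp add: positive_op_def complex_nonneg_Reals_iff blinfun.diff_left cinner.diff_right
        cinner_scaleC_right cinner_self power_mult_distrib flip: of_real_power of_real_mult)
  then have "(norm (\<Phi> x \<zeta>))\<^sup>2 \<le> (norm x * norm \<zeta>)\<^sup>2"
    using ucp_Schwarz(2)[OF \<Phi> x, of \<zeta>] by linarith
  then show "norm (\<Phi> x \<zeta>) \<le> norm x * norm \<zeta>"
    by (rule power2_le_imp_le) simp
qed simp

text \<open>Apply \<open>\<psi>\<close> to the Kadison--Schwarz inequality and use \<open>\<psi> \<circ> \<Phi> = \<phi>\<close>.\<close>

lemma ucp_gnorm_le:
  assumes \<Phi>: "\<Phi> \<in> ucp_maps" and x: "x \<in> M"
  shows "N.gnorm (\<Phi> x) \<le> M.gnorm x"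
proof (rule power2_le_imp_le)
  let ?X = "op_adjoint x o\<^sub>L x" and ?Y = "op_adjoint (\<Phi> x) o\<^sub>L \<Phi> x"
  have X: "?X \<in> M" and \<Phi>x: "\<Phi> x \<in> N"
    using x \<Phi> by (auto intro: M.compose_mem M.adjoint_mem ucp_mem)
  have "positive_op (\<Phi> ?X - ?Y)"
    unfolding positive_op_def complex_nonneg_Reals_iff
    using ucp_Schwarz[OF \<Phi> x]
    by (simp add: blinfun.diff_left cinner.diff_right op_adjoint_right N.bounded_op \<Phi>x cinner_self
        complex_nonneg_Reals_iff flip: of_real_power)
  then have "Re (\<psi> ?Y) \<le> Re (\<psi> (\<Phi> ?X))"
    by (intro N.state_mono N.compose_mem N.adjoint_mem \<Phi>x ucp_mem[OF \<Phi> X])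
  then show "(N.gnorm (\<Phi> x))\<^sup>2 \<le> (M.gnorm x)\<^sup>2"
    by (simp add: ucp_state[OF \<Phi> X] N.state_square \<Phi>x M.state_square x del: of_real_power)
qed (simp add: M.gnorm_nonneg x)

lemma ucp_dist_le:
  assumes \<Phi>: "\<Phi> \<in> ucp_maps" "\<Phi>' \<in> ucp_maps" and x: "x \<in> M" "d \<in> M"
  shows "N.gnorm (\<Phi> x - \<Phi>' x) \<le> 2 * M.gnorm (x - d) + N.gnorm (\<Phi> d - \<Phi>' d)"
proof -
  note mem = ucp_mem[OF \<Phi>(1)] ucp_mem[OF \<Phi>(2)]
  have "N.gnorm (\<Phi> x - \<Phi>' x) \<le> N.gnorm (\<Phi> x - \<Phi> d) + N.gnorm (\<Phi> d - \<Phi>' x)"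
    by (intro N.gnorm_diff_triangle mem x)
  also have "N.gnorm (\<Phi> d - \<Phi>' x) \<le> N.gnorm (\<Phi> d - \<Phi>' d) + N.gnorm (\<Phi>' d - \<Phi>' x)"
    by (intro N.gnorm_diff_triangle mem x)
  also have "N.gnorm (\<Phi>' d - \<Phi>' x) = N.gnorm (\<Phi>' x - \<Phi>' d)"
    by (intro N.gnorm_diff_commute mem x)
  finally show ?thesis
    using ucp_gnorm_le[OF \<Phi>(1) M.diff_mem[OF x]] ucp_gnorm_le[OF \<Phi>(2) M.diff_mem[OF x]]
    by (simp add: ucp_diff \<Phi> x)
qed

text \<open>Compactness of the set of ucp maps for pointwise weak convergence. All of the defining
  conditions pass to weak limits; for the state this uses that \<open>\<psi>\<close> is normal.\<close>

lemma ucp_maps_convergent_subfilter: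
  assumes F: "F \<noteq> bot" and ev: "\<forall>\<^sub>F \<Phi> in F. \<Phi> \<in> ucp_maps"
  obtains G \<Psi> where "G \<le> F" "G \<noteq> bot" "\<Psi> \<in> ucp_maps"
    "\<And>x. x \<in> M \<Longrightarrow> wot_tendsto (\<lambda>\<Phi>. \<Phi> x) (\<Psi> x) G"
proof -
  have "\<forall>\<^sub>F \<Phi> in F. \<forall>x. (if x \<in> M then \<Phi> x else 0) \<in> bounded_ops \<and> norm (if x \<in> M then \<Phi> x else 0) \<le> norm x"
    using ev
  proof eventually_elim
    case (elim \<Phi>)
    then show ?case
      by (auto simp: ucp_mem N.bounded_op ucp_norm_le N.zero_mem)
  qed
  from bounded_ops_wot_convergent_subfilter[OF F this]
  obtain G l where G: "G \<le> F" "G \<noteq> bot" and l0: "\<And>x. wot_tendsto (\<lambda>\<Phi>. if x \<in> M then \<Phi> x else 0) (l x) G"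
    and l_op: "\<And>x. l x \<in> bounded_ops" and l_norm: "\<And>x. norm (l x) \<le> norm x"
    by metis
  have evG: "\<forall>\<^sub>F \<Phi> in G. \<Phi> \<in> ucp_maps"
    using G(1) ev by (rule filter_leD)
  define \<Psi> where "\<Psi> = restrict l M"
  have lim: "wot_tendsto (\<lambda>\<Phi>. \<Phi> x) (\<Psi> x) G" if "x \<in> M" for x
    using l0[of x] that by (simp add: \<Psi>_def)
  have mem: "\<Psi> x \<in> N" if x: "x \<in> M" for x
  proof (rule N.wot_limit_mem[OF lim[OF x] _ G(2)])
    show "\<forall>\<^sub>F \<Phi> in G. \<Phi> x \<in> N"
      using evG by eventually_elim (rule ucp_mem[OF _ x])
    show "\<Psi> x \<in> bounded_ops"
      using x l_op by (simp add: \<Psi>_def)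
  qed
  have "ucp_map M N \<Psi>"
    unfolding ucp_map_def
  proof (intro conjI ballI allI impI)
    show "\<Psi> \<in> M \<rightarrow>\<^sub>E N"
      using mem by (auto simp: \<Psi>_def)
    show "\<Psi> (x + y) = \<Psi> x + \<Psi> y" if x: "x \<in> M" and y: "y \<in> M" for x y
    proof (rule wot_limit_unique[OF _ wot_tendsto_add[OF lim[OF x] lim[OF y]] G(2)])
      have "\<forall>\<^sub>F \<Phi> in G. \<Phi> (x + y) = \<Phi> x + \<Phi> y"
        using evG by eventually_elim (rule ucp_add[OF _ x y])
      then show "wot_tendsto (\<lambda>\<Phi>. \<Phi> x + \<Phi> y) (\<Psi> (x + y)) G"
        using lim[OF M.add_mem[OF x y]] by (rule wot_tendsto_cong)
    qed
    show "\<Psi> (op_scale c x) = op_scale c (\<Psi> x)" if x: "x \<in> M" for c x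
    proof (rule wot_limit_unique[OF _ wot_tendsto_op_scale[OF lim[OF x]] G(2)])
      have "\<forall>\<^sub>F \<Phi> in G. \<Phi> (op_scale c x) = op_scale c (\<Phi> x)"
        using evG by eventually_elim (rule ucp_op_scale[OF _ x])
      then show "wot_tendsto (\<lambda>\<Phi>. op_scale c (\<Phi> x)) (\<Psi> (op_scale c x)) G"
        using lim[OF M.op_scale_mem[OF x]] by (rule wot_tendsto_cong)
    qed
    show "\<Psi> id_blinfun = id_blinfun"
    proof (rule wot_limit_unique[OF _ wot_tendsto_const G(2)])
      have "\<forall>\<^sub>F \<Phi> in G. \<Phi> id_blinfun = id_blinfun"
        using evG by eventually_elim (rule ucp_id)
      then show "wot_tendsto (\<lambda>\<Phi>. id_blinfun) (\<Psi> id_blinfun) G"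
        using lim[OF M.id_mem] by (rule wot_tendsto_cong)
    qed
    fix n x
    assume x: "(\<forall>i<n. \<forall>j<n. x i j \<in> M) \<and> positive_matrix n x"
    show "positive_matrix n (\<lambda>i j. \<Psi> (x i j))"
      unfolding positive_matrix_def cinner.sum_right
    proof
      fix \<xi> :: "nat \<Rightarrow> 'k"
      show "(\<Sum>i<n. \<Sum>j<n. cinner (\<xi> i) (\<Psi> (x i j) (\<xi> j))) \<in> \<real>\<^sub>\<ge>\<^sub>0"
      proof (rule Lim_in_closed_set[OF closed_nonneg_Reals_complex _ G(2)])
        show "((\<lambda>\<Phi>. \<Sum>i<n. \<Sum>j<n. cinner (\<xi> i) (blinfun_apply (\<Phi> (x i j)) (\<xi> j))) \<longlongrightarrow>
            (\<Sum>i<n. \<Sum>j<n. cinner (\<xi> i) (\<Psi> (x i j) (\<xi> j)))) G"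
          using x by (intro tendsto_sum wot_tendstoD[OF lim]) auto
        show "\<forall>\<^sub>F \<Phi> in G. (\<Sum>i<n. \<Sum>j<n. cinner (\<xi> i) (blinfun_apply (\<Phi> (x i j)) (\<xi> j))) \<in> \<real>\<^sub>\<ge>\<^sub>0"
          using evG
        proof eventually_elim
          case (elim \<Phi>)
          then have "positive_matrix n (\<lambda>i j. \<Phi> (x i j))"
            using x by (intro ucp_positive_matrix) auto
          then show ?case
            by (simp add: positive_matrix_def cinner.sum_right)
        qed
      qed
    qed
  qed
  moreover have "\<psi> (\<Psi> x) = \<phi> x" if x: "x \<in> M" for x
  proof (rule tendsto_unique[OF G(2)])
    have "\<forall>\<^sub>F \<Phi> in G. \<Phi> x \<in> N \<and> norm (\<Phi> x) \<le> norm x"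
      using evG by eventually_elim (simp add: ucp_mem ucp_norm_le x)
    then show "((\<lambda>\<Phi>. \<psi> (\<Phi> x)) \<longlongrightarrow> \<psi> (\<Psi> x)) G"
      using N.state_wot_tendsto[OF lim[OF x] _ mem[OF x] G(2) N.id_mem N.id_mem] by simp
    have "\<forall>\<^sub>F \<Phi> in G. \<phi> x = \<psi> (\<Phi> x)"
      using evG by eventually_elim (simp add: ucp_state x)
    then show "((\<lambda>\<Phi>. \<psi> (\<Phi> x)) \<longlongrightarrow> \<phi> x) G"
      using tendsto_const by (rule Lim_transform_eventually[rotated])
  qed
  ultimately have "\<Psi> \<in> ucp_maps"
    by (simp add: state_preserving_ucp_maps_def)
  then show ?thesis
    using that[OF G _ lim] by blast
qed

section \<open>The space of maps as a closed subspace of a countable product of balls\<close>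

text \<open>A map is recorded by its values on a set \<open>D\<close>, with the GNS metric on the ball of radius \<open>\<parallel>d\<parallel>\<close>
  as range at \<open>d\<close>.\<close>

definition ball_product :: "('h \<Rightarrow>\<^sub>L 'h) set \<Rightarrow> (('h \<Rightarrow>\<^sub>L 'h) \<Rightarrow> ('k \<Rightarrow>\<^sub>L 'k)) topology" where
  "ball_product D = product_topology (\<lambda>d. Metric_space.mtopology (N.oball (norm d)) N.gdist) D"

lemma completely_metrizable_ball_product:
  assumes "countable D"
  shows "completely_metrizable_space (ball_product D)"
proof -
  have "completely_metrizable_space (Metric_space.mtopology (N.oball r) N.gdist)" for r
    by (rule Metric_space.completely_metrizable_space_mtopology[OF N.Metric_space_oball N.mcomplete_oball])
  then show ?thesis
    unfolding ball_product_def completely_metrizable_space_product_topology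
    using assms by (auto intro: countable_subset)
qed

lemma ucp_oball: "\<Phi> \<in> ucp_maps \<Longrightarrow> x \<in> M \<Longrightarrow> \<Phi> x \<in> N.oball (norm x)"
  by (simp add: N.oball_def ucp_mem ucp_norm_le)

lemma topspace_pointwise_strong [simp]: "topspace (pointwise_strong_topology M \<phi> N \<psi>) = ucp_maps"
  by (simp add: pointwise_strong_topology_def initial_topology_topspace)

text \<open>Let the restrictions of maps \<open>f n\<close> converge to \<open>l\<close>, and let \<open>\<Psi>\<close> be a weak cluster point of the
  \<open>f n\<close>. Then \<open>f n d - l d\<close> tends to 0 in the GNS norm and clusters weakly at \<open>\<Psi> d - l d\<close>, which is
  therefore 0 by lower semicontinuity. Thus \<open>l\<close> extends to the map \<open>\<Psi>\<close>.\<close>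

lemma closedin_restricted_maps:
  assumes D: "countable D" "D \<subseteq> M"
  shows "closedin (ball_product D) ((\<lambda>\<Phi>. restrict \<Phi> D) ` ucp_maps)"
proof -
  obtain X d where X: "Metric_space X d" "ball_product D = Metric_space.mtopology X d"
    using completely_metrizable_imp_metrizable_space[OF completely_metrizable_ball_product[OF D(1)]]
    unfolding metrizable_space_def by blast
  interpret X: Metric_space X d
    by (rule X(1))
  have "l \<in> (\<lambda>\<Phi>. restrict \<Phi> D) ` ucp_maps"
    if s: "range s \<subseteq> (\<lambda>\<Phi>. restrict \<Phi> D) ` ucp_maps" and lim: "limitin (ball_product D) s l sequentially" for s l
  proof -
    have "\<exists>\<Phi>. \<Phi> \<in> ucp_maps \<and> s n = restrict \<Phi> D" for n
      using s by auto
    then obtain f where f: "\<And>n. f n \<in> ucp_maps" "\<And>n. s n = restrict (f n) D"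
      by metis
    obtain G \<Psi> where G: "G \<le> filtermap f sequentially" "G \<noteq> bot" and \<Psi>: "\<Psi> \<in> ucp_maps"
      and wot: "\<And>x. x \<in> M \<Longrightarrow> wot_tendsto (\<lambda>\<Phi>. \<Phi> x) (\<Psi> x) G"
      by (rule ucp_maps_convergent_subfilter[of "filtermap f sequentially"])
        (simp_all add: filtermap_bot_iff eventually_filtermap f(1))
    have ucpG: "\<forall>\<^sub>F \<Phi> in G. \<Phi> \<in> ucp_maps"
      by (rule filter_leD[OF G(1)]) (simp add: eventually_filtermap f(1))
    have l: "l \<in> extensional D"
        "\<And>d. d \<in> D \<Longrightarrow> limitin (Metric_space.mtopology (N.oball (norm d)) N.gdist) (\<lambda>n. s n d) (l d) sequentially"
      using lim unfolding ball_product_def limitin_componentwise by auto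
    have "\<Psi> d = l d" if d: "d \<in> D" for d
    proof -
      have dM: "d \<in> M"
        using d D(2) by blast
      interpret B: Metric_space "N.oball (norm d)" N.gdist
        by (rule N.Metric_space_oball)
      have ld: "l d \<in> N.oball (norm d)"
        using l(2)[OF d] by (simp add: B.limitin_metric)
      then have ldN: "l d \<in> N" "norm (l d) \<le> norm d"
        by (auto simp: N.oball_def)
      have "N.gnorm (\<Psi> d - l d) \<le> e" if e: "0 < e" for e
      proof (rule N.gnorm_wot_lower_semicontinuous[OF _ _ _ G(2)])
        show "wot_tendsto (\<lambda>\<Phi>. \<Phi> d - l d) (\<Psi> d - l d) G"
          by (rule wot_tendsto_diff[OF wot[OF dM] wot_tendsto_const])
        show "\<forall>\<^sub>F \<Phi> in G. \<Phi> d - l d \<in> N \<and> norm (\<Phi> d - l d) \<le> norm d + norm d"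
          using ucpG
        proof eventually_elim
          case (elim \<Phi>)
          show ?case
            using norm_triangle_ineq4[of "\<Phi> d" "l d"] ucp_norm_le[OF elim dM] ldN ucp_mem[OF elim dM]
            by (simp add: N.diff_mem)
        qed
        show "\<Psi> d - l d \<in> N"
          using ucp_mem[OF \<Psi> dM] ldN(1) by (rule N.diff_mem)
        have "\<forall>\<^sub>F n in sequentially. N.gnorm (f n d - l d) \<le> e"
        proof -
          have "\<forall>\<^sub>F n in sequentially. s n d \<in> N.oball (norm d) \<and> N.gdist (s n d) (l d) < e"
            using l(2)[OF d] e by (simp add: B.limitin_metric)
          then show ?thesis
            by eventually_elim (use d ldN ucp_mem[OF f(1) dM] in \<open>simp add: f(2) N.gdist_def\<close>)
        qed
        then show "\<forall>\<^sub>F \<Phi> in G. N.gnorm (\<Phi> d - l d) \<le> e"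
          by (intro filter_leD[OF G(1)]) (simp add: eventually_filtermap)
      qed
      then have "N.gnorm (\<Psi> d - l d) \<le> 0"
        by (rule field_le_epsilon) simp
      then show ?thesis
        using N.gnorm_eq_0[of "\<Psi> d - l d"] N.gnorm_nonneg[of "\<Psi> d - l d"] N.diff_mem ucp_mem[OF \<Psi> dM] ldN(1)
        by force
    qed
    then have "l = restrict \<Psi> D"
      using l(1) by (intro extensionalityI[of _ D]) auto
    then show ?thesis
      using \<Psi> by blast
  qed
  moreover have "(\<lambda>\<Phi>. restrict \<Phi> D) ` ucp_maps \<subseteq> X"
  proof -
    have "restrict \<Phi> D \<in> topspace (ball_product D)" if "\<Phi> \<in> ucp_maps" for \<Phi>
      using that D(2) ucp_oball
      by (auto simp: ball_product_def Metric_space.topspace_mtopology[OF N.Metric_space_oball])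
    then show ?thesis
      by (auto simp: X(2))
  qed
  ultimately show ?thesis
    unfolding X(2) X.metric_closedin_iff_sequentially_closed by blast
qed

text \<open>For the continuity of the inverse, fix \<open>x\<close> and choose \<open>d \<in> D\<close> near \<open>x\<close>: by the uniform Lipschitz
  bound, maps that are close at the single point \<open>d\<close> are close at \<open>x\<close>. Their values at \<open>x\<close> lie in the
  ball of radius \<open>\<parallel>x\<parallel>\<close>, where closeness in the GNS norm implies closeness in the strong topology.\<close>

lemma restriction_homeomorphism:
  assumes D: "D \<subseteq> M" and dense: "\<And>x e. x \<in> M \<Longrightarrow> 0 < e \<Longrightarrow> \<exists>d\<in>D. M.gnorm (x - d) < e"
  shows "homeomorphic_maps (pointwise_strong_topology M \<phi> N \<psi>)
    (subtopology (ball_product D) ((\<lambda>\<Phi>. restrict \<Phi> D) ` ucp_maps))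
    (\<lambda>\<Phi>. restrict \<Phi> D) (inv_into ucp_maps (\<lambda>\<Phi>. restrict \<Phi> D))"
    (is "homeomorphic_maps ?X ?Y ?r ?inv")
proof -
  have inj: "inj_on ?r ucp_maps"
  proof (rule inj_onI)
    fix \<Phi> \<Phi>'
    assume \<Phi>: "\<Phi> \<in> ucp_maps" "\<Phi>' \<in> ucp_maps" and eq: "?r \<Phi> = ?r \<Phi>'"
    show "\<Phi> = \<Phi>'"
    proof (rule PiE_ext[OF ucp_extensional[OF \<Phi>(1)] ucp_extensional[OF \<Phi>(2)]])
      fix x
      assume x: "x \<in> M"
      have "N.gnorm (\<Phi> x - \<Phi>' x) \<le> 0 + e" if e: "0 < e" for e
      proof -
        obtain d where d: "d \<in> D" "M.gnorm (x - d) < e / 2"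
          using dense[OF x, of "e / 2"] e by auto
        have "\<Phi> d = \<Phi>' d"
          using fun_cong[OF eq, of d] d(1) by simp
        then show ?thesis
          using ucp_dist_le[OF \<Phi> x, of d] d D by auto
      qed
      then have "N.gnorm (\<Phi> x - \<Phi>' x) \<le> 0"
        by (rule field_le_epsilon)
      moreover have "\<Phi> x - \<Phi>' x \<in> N"
        using \<Phi> x by (intro N.diff_mem ucp_mem)
      ultimately show "\<Phi> x = \<Phi>' x"
        using N.gnorm_eq_0[of "\<Phi> x - \<Phi>' x"] N.gnorm_nonneg[of "\<Phi> x - \<Phi>' x"] by simp
    qed
  qed
  have r_top: "?r \<Phi> \<in> topspace (ball_product D)" if "\<Phi> \<in> ucp_maps" for \<Phi>
    using that D ucp_oball
    by (auto simp: ball_product_def Metric_space.topspace_mtopology[OF N.Metric_space_oball])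
  have topY: "topspace ?Y = ?r ` ucp_maps"
    using r_top by auto
  have "continuous_map ?X (ball_product D) ?r"
    unfolding ball_product_def continuous_map_componentwise
  proof (intro conjI ballI)
    fix d
    assume d: "d \<in> D"
    then have dM: "d \<in> M"
      using D by blast
    interpret B: Metric_space "N.oball (norm d)" N.gdist
      by (rule N.Metric_space_oball)
    show "continuous_map ?X B.mtopology (\<lambda>\<Phi>. ?r \<Phi> d)"
      unfolding B.continuous_map_to_metric
    proof (intro ballI allI impI)
      fix \<Phi> and e :: real
      assume "\<Phi> \<in> topspace ?X" and e: "0 < e"
      then have \<Phi>: "\<Phi> \<in> ucp_maps"
        by simp
      obtain V where V: "openin (strong_topology N \<psi>) V" "\<Phi> d \<in> V" "\<And>y. y \<in> V \<Longrightarrow> N.gnorm (\<Phi> d - y) < e"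
        using N.strong_topology_ball_nhd[OF ucp_mem[OF \<Phi> dM] e] by metis
      have "continuous_map ?X (strong_topology N \<psi>) (\<lambda>\<Phi>. \<Phi> d)"
        unfolding pointwise_strong_topology_def
        by (rule initial_topology_continuous_map[where f = "\<lambda>x \<Phi>. \<Phi> x"]) (auto simp: dM ucp_mem)
      from openin_continuous_map_preimage[OF this V(1)]
      have "openin ?X {\<Phi>' \<in> ucp_maps. \<Phi>' d \<in> V}"
        by simp
      moreover have "?r \<Phi>' d \<in> B.mball (?r \<Phi> d) e" if "\<Phi>' \<in> ucp_maps" "\<Phi>' d \<in> V" for \<Phi>'
        using V(3) that \<Phi> d dM by (simp add: ucp_oball ucp_mem N.gdist_def)
      ultimately show "\<exists>U. openin ?X U \<and> \<Phi> \<in> U \<and> (\<forall>\<Phi>'\<in>U. ?r \<Phi>' d \<in> B.mball (?r \<Phi> d) e)"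
        using \<Phi> V(2) by (intro exI[of _ "{\<Phi>' \<in> ucp_maps. \<Phi>' d \<in> V}"]) simp
    qed
  qed auto
  then have "continuous_map ?X ?Y ?r"
    by (intro continuous_map_into_subtopology) auto
  moreover have "continuous_map ?Y ?X ?inv"
    unfolding pointwise_strong_topology_def strong_topology_def[of N]
  proof (intro initial_topology_continuous_map_into)
    show "?inv \<in> topspace ?Y \<rightarrow> ucp_maps"
      unfolding topY by (auto intro: inv_into_into)
    show "(\<lambda>t. ?inv t x) \<in> topspace ?Y \<rightarrow> N" if "x \<in> M" for x
      using that unfolding topY by (auto intro: ucp_mem inv_into_into)
  next
    fix x \<xi>
    assume x: "x \<in> M" and \<xi>: "\<xi> \<in> gns_space N \<psi>"
    interpret G: Metric_space "gns_space N \<psi>"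
      "\<lambda>\<xi> \<eta>. if \<xi> \<in> gns_space N \<psi> \<and> \<eta> \<in> gns_space N \<psi> then gns_dist \<psi> \<xi> \<eta> else 0"
      by (rule N.Metric_space_gns)
    show "continuous_map ?Y (metric_topology (gns_space N \<psi>) (gns_dist \<psi>)) (\<lambda>t. gns_action N \<psi> (?inv t x) \<xi>)"
      unfolding metric_topology_def G.continuous_map_to_metric
    proof (intro ballI allI impI)
      fix t and e :: real
      assume t: "t \<in> topspace ?Y" and e: "0 < e"
      obtain \<Phi> where \<Phi>: "\<Phi> \<in> ucp_maps" "t = ?r \<Phi>"
        using t unfolding topY by blast
      obtain \<delta> where \<delta>: "0 < \<delta>" "\<And>y y'. y \<in> N.oball (norm x) \<Longrightarrow> y' \<in> N.oball (norm x) \<Longrightarrow>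
          N.gnorm (y - y') < \<delta> \<Longrightarrow> gns_dist \<psi> (gns_action N \<psi> y \<xi>) (gns_action N \<psi> y' \<xi>) < e"
        using N.gns_action_continuous_on_bounded[OF \<xi> e, of "norm x"] by blast
      obtain d where d: "d \<in> D" "M.gnorm (x - d) < \<delta> / 3"
        using dense[OF x, of "\<delta> / 3"] \<delta>(1) by auto
      have dM: "d \<in> M"
        using d D by blast
      interpret B: Metric_space "N.oball (norm d)" N.gdist
        by (rule N.Metric_space_oball)
      define U where "U = {t \<in> topspace ?Y. t d \<in> B.mball (\<Phi> d) (\<delta> / 3)}"
      have "continuous_map ?Y B.mtopology (\<lambda>t. t d)"
        unfolding ball_product_def
        by (intro continuous_map_from_subtopology continuous_map_product_projection d)
      then have "openin ?Y U"
        unfolding U_def by (rule openin_continuous_map_preimage) (rule B.openin_mball)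
      moreover have "t \<in> U"
        unfolding U_def using t \<delta>(1) d(1) dM \<Phi> by (simp add: ucp_oball)
      moreover have "gns_action N \<psi> (?inv t' x) \<xi> \<in> G.mball (gns_action N \<psi> (?inv t x) \<xi>) e" if t': "t' \<in> U" for t'
      proof -
        obtain \<Phi>' where \<Phi>': "\<Phi>' \<in> ucp_maps" "t' = ?r \<Phi>'"
          using t' unfolding U_def topY by blast
        have "N.gnorm (\<Phi> d - \<Phi>' d) < \<delta> / 3"
          using t' d(1) \<Phi> \<Phi>' dM by (simp add: U_def N.gdist_def ucp_mem)
        then have "N.gnorm (\<Phi> x - \<Phi>' x) < \<delta>"
          using ucp_dist_le[OF \<Phi>(1) \<Phi>'(1) x dM] d(2) by simp
        then have "gns_dist \<psi> (gns_action N \<psi> (\<Phi> x) \<xi>) (gns_action N \<psi> (\<Phi>' x) \<xi>) < e"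
          using \<Phi>(1) \<Phi>'(1) x by (intro \<delta>(2) ucp_oball)
        moreover have "?inv t = \<Phi>" "?inv t' = \<Phi>'"
          using \<Phi> \<Phi>' inv_into_f_f[OF inj] by auto
        ultimately show ?thesis
          using \<Phi>(1) \<Phi>'(1) x \<xi> by (simp add: N.gns_action_mem ucp_mem)
      qed
      ultimately show "\<exists>U. openin ?Y U \<and> t \<in> U \<and>
          (\<forall>t'\<in>U. gns_action N \<psi> (?inv t' x) \<xi> \<in> G.mball (gns_action N \<psi> (?inv t x) \<xi>) e)"
        by blast
    qed
  qed
  moreover have "?inv (?r \<Phi>) = \<Phi>" if "\<Phi> \<in> ucp_maps" for \<Phi>
    by (rule inv_into_f_f[OF inj that])
  ultimately show ?thesis
    unfolding homeomorphic_maps_def topY by auto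
qed

text \<open>A basic neighbourhood restricts finitely many values \<open>\<Phi> d\<close>, \<open>d \<in> D\<close>, and contains the maps whose
  values there are sufficiently near to suitable elements of \<open>E\<close>. There are countably many such
  conditions, and one picks a map for each that can be satisfied.\<close>

lemma separable_pointwise_strong:
  assumes D: "countable D" "D \<subseteq> M" and denseD: "\<And>x e. x \<in> M \<Longrightarrow> 0 < e \<Longrightarrow> \<exists>d\<in>D. M.gnorm (x - d) < e"
    and E: "countable E" "E \<subseteq> N" and denseE: "\<And>y e. y \<in> N \<Longrightarrow> 0 < e \<Longrightarrow> \<exists>a\<in>E. N.gnorm (y - a) < e"
  shows "separable_space (pointwise_strong_topology M \<phi> N \<psi>)"
proof -
  let ?X = "pointwise_strong_topology M \<phi> N \<psi>" and ?r = "\<lambda>\<Phi>. restrict \<Phi> D"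
  let ?Y = "subtopology (ball_product D) (?r ` ucp_maps)" and ?inv = "inv_into ucp_maps ?r"
  have hom: "continuous_map ?Y ?X ?inv" "\<And>\<Phi>. \<Phi> \<in> ucp_maps \<Longrightarrow> ?inv (?r \<Phi>) = \<Phi>"
    using restriction_homeomorphism[OF D(2) denseD] by (auto simp: homeomorphic_maps_def)
  have r_top: "?r \<Phi> \<in> topspace ?Y" if "\<Phi> \<in> ucp_maps" for \<Phi>
    using that restriction_homeomorphism[OF D(2) denseD]
    by (auto simp: homeomorphic_maps_def continuous_map_def)
  define B where "B L = {\<Phi> \<in> ucp_maps. \<forall>(d, a, n)\<in>L. N.gnorm (\<Phi> d - a) < 1 / Suc n}"
    for L :: "(('h \<Rightarrow>\<^sub>L 'h) \<times> ('k \<Rightarrow>\<^sub>L 'k) \<times> nat) set"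
  define codes where "codes = {L. finite L \<and> L \<subseteq> D \<times> E \<times> (UNIV :: nat set)}"
  have "countable codes"
    unfolding codes_def using D(1) E(1) by (intro countable_Collect_finite_subset countable_SIGMA) auto
  then have "countable (B ` codes)"
    by simp
  from countable_meeting_set[OF this]
  obtain A where A: "countable A" "A \<subseteq> \<Union>(B ` codes)" "\<forall>X\<in>B ` codes. X \<noteq> {} \<longrightarrow> A \<inter> X \<noteq> {}"
    by (elim exE conjE)
  have "\<exists>a\<in>A. a \<in> U" if U: "openin ?X U" "\<Phi> \<in> U" for U \<Phi>
  proof -
    have \<Phi>: "\<Phi> \<in> ucp_maps"
      using openin_subset[OF U(1)] U(2) by auto
    have "openin ?Y {t \<in> topspace ?Y. ?inv t \<in> U}"
      using hom(1) U(1) by (rule openin_continuous_map_preimage)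
    then obtain W where W: "openin (ball_product D) W" "{t \<in> topspace ?Y. ?inv t \<in> U} = W \<inter> ?r ` ucp_maps"
      unfolding openin_subtopology by blast
    have "?r \<Phi> \<in> W"
      using W(2) r_top[OF \<Phi>] hom(2)[OF \<Phi>] U(2) by auto
    then obtain V where V: "finite {d \<in> D. V d \<noteq> topspace (Metric_space.mtopology (N.oball (norm d)) N.gdist)}"
        "\<forall>d\<in>D. openin (Metric_space.mtopology (N.oball (norm d)) N.gdist) (V d)"
        "?r \<Phi> \<in> Pi\<^sub>E D V" "Pi\<^sub>E D V \<subseteq> W"
      using W(1) unfolding ball_product_def openin_product_topology_alt by meson
    define I where "I = {d \<in> D. V d \<noteq> N.oball (norm d)}"
    have I: "finite I" "I \<subseteq> D"
      using V(1) by (auto simp: I_def Metric_space.topspace_mtopology[OF N.Metric_space_oball])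
    have "\<exists>a n. a \<in> E \<and> N.gnorm (\<Phi> d - a) < 1 / Suc n \<and>
        (\<forall>\<Phi>'\<in>ucp_maps. N.gnorm (\<Phi>' d - a) < 1 / Suc n \<longrightarrow> \<Phi>' d \<in> V d)" if d: "d \<in> D" for d
    proof -
      have dM: "d \<in> M"
        using d D(2) by blast
      interpret B: Metric_space "N.oball (norm d)" N.gdist
        by (rule N.Metric_space_oball)
      have "\<Phi> d \<in> V d"
        using V(3) d by (auto simp: PiE_iff)
      moreover have "openin B.mtopology (V d)"
        using V(2) d by blast
      ultimately obtain r where r: "0 < r" "B.mball (\<Phi> d) r \<subseteq> V d"
        unfolding B.openin_mtopology by blast
      obtain n where n: "inverse (real (Suc n)) < r / 2"
        using reals_Archimedean[of "r / 2"] r(1) by auto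
      obtain a where a: "a \<in> E" "N.gnorm (\<Phi> d - a) < 1 / Suc n"
        using denseE[OF ucp_mem[OF \<Phi> dM], of "1 / Suc n"] by auto
      have "\<Phi>' d \<in> V d" if \<Phi>': "\<Phi>' \<in> ucp_maps" "N.gnorm (\<Phi>' d - a) < 1 / Suc n" for \<Phi>'
      proof -
        have aN: "a \<in> N"
          using a(1) E(2) by blast
        have "N.gnorm (\<Phi> d - \<Phi>' d) \<le> N.gnorm (\<Phi> d - a) + N.gnorm (a - \<Phi>' d)"
          by (intro N.gnorm_diff_triangle ucp_mem \<Phi> \<Phi>'(1) dM aN)
        also have "N.gnorm (a - \<Phi>' d) = N.gnorm (\<Phi>' d - a)"
          by (intro N.gnorm_diff_commute ucp_mem \<Phi>'(1) dM aN)
        finally have "N.gnorm (\<Phi> d - \<Phi>' d) < r"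
          using a(2) \<Phi>'(2) n by (simp add: inverse_eq_divide)
        then show ?thesis
          using r(2) \<Phi> \<Phi>'(1) dM by (auto simp: ucp_oball N.gdist_def ucp_mem)
      qed
      then show ?thesis
        using a by blast
    qed
    then obtain a n where an: "\<And>d. d \<in> D \<Longrightarrow> a d \<in> E" "\<And>d. d \<in> D \<Longrightarrow> N.gnorm (\<Phi> d - a d) < 1 / Suc (n d)"
        "\<And>d \<Phi>'. d \<in> D \<Longrightarrow> \<Phi>' \<in> ucp_maps \<Longrightarrow> N.gnorm (\<Phi>' d - a d) < 1 / Suc (n d) \<Longrightarrow> \<Phi>' d \<in> V d"
      by metis
    define L where "L = (\<lambda>d. (d, a d, n d)) ` I"
    have "L \<in> codes"
      unfolding codes_def L_def using I an(1) by auto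
    moreover have "\<Phi> \<in> B L"
      unfolding B_def L_def using \<Phi> I(2) an(2) by auto
    ultimately obtain \<Phi>' where \<Phi>': "\<Phi>' \<in> A" "\<Phi>' \<in> B L"
      using A(3) by blast
    then have ucp': "\<Phi>' \<in> ucp_maps"
      by (simp add: B_def)
    have "\<Phi>' d \<in> V d" if d: "d \<in> D" for d
    proof (cases "d \<in> I")
      case True
      then have "N.gnorm (\<Phi>' d - a d) < 1 / Suc (n d)"
        using \<Phi>'(2) unfolding B_def L_def by auto
      then show ?thesis
        using an(3)[OF d ucp'] by blast
    next
      case False
      then show ?thesis
        using d D(2) ucp_oball[OF ucp'] by (auto simp: I_def)
    qed
    then have "?r \<Phi>' \<in> W"
      using V(4) by auto
    then have "?inv (?r \<Phi>') \<in> U"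
      using W(2) ucp' by blast
    then show ?thesis
      using \<Phi>'(1) hom(2)[OF ucp'] by auto
  qed
  moreover have "A \<subseteq> ucp_maps"
    using A(2) by (auto simp: B_def)
  ultimately have "?X closure_of A = ucp_maps"
    by (auto simp: closure_of_def)
  then show ?thesis
    unfolding separable_space_def using A(1) \<open>A \<subseteq> ucp_maps\<close> by auto
qed

end

theorem theorem1p2:
  fixes M :: "('h::chilbert_space \<Rightarrow>\<^sub>L 'h) set" and \<phi> :: "('h \<Rightarrow>\<^sub>L 'h) \<Rightarrow> complex"
    and N :: "('k::chilbert_space \<Rightarrow>\<^sub>L 'k) set" and \<psi> :: "('k \<Rightarrow>\<^sub>L 'k) \<Rightarrow> complex"
  assumes "von_neumann_algebra M" and "separable_predual M"
    and "von_neumann_algebra N" and "separable_predual N"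
    and "faithful_normal_state M \<phi>" and "faithful_normal_state N \<psi>"
  shows "Polish_topology (pointwise_strong_topology M \<phi> N \<psi>)"
proof -
  interpret state_pair M \<phi> N \<psi>
    by unfold_locales (use assms in auto)
  obtain D where D: "countable D" "D \<subseteq> M" "\<And>x e. x \<in> M \<Longrightarrow> 0 < e \<Longrightarrow> \<exists>d\<in>D. M.gnorm (x - d) < e"
    using M.separable_gnorm[OF assms(2)] by metis
  obtain E where E: "countable E" "E \<subseteq> N" "\<And>y e. y \<in> N \<Longrightarrow> 0 < e \<Longrightarrow> \<exists>a\<in>E. N.gnorm (y - a) < e"
    using N.separable_gnorm[OF assms(4)] by metis
  have "pointwise_strong_topology M \<phi> N \<psi> homeomorphic_space
      subtopology (ball_product D) ((\<lambda>\<Phi>. restrict \<Phi> D) ` ucp_maps)"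
    using restriction_homeomorphism[OF D(2,3)] homeomorphic_space_def by blast
  moreover have "completely_metrizable_space (subtopology (ball_product D) ((\<lambda>\<Phi>. restrict \<Phi> D) ` ucp_maps))"
    using completely_metrizable_ball_product[OF D(1)] closedin_restricted_maps[OF D(1,2)]
    by (rule completely_metrizable_space_closedin)
  ultimately have "completely_metrizable_space (pointwise_strong_topology M \<phi> N \<psi>)"
    by (simp add: homeomorphic_completely_metrizable_space)
  then show ?thesis
    using separable_pointwise_strong[OF D E] by (simp add: Polish_topology_def)
qed

end
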